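(* In $\pi_1(\mathbb{H}^+,b_0^+)$, we have $p_\tau\notin cl_{C,c_\tau}(P)$.
   Context: A map is a continuous function; $f_{\#}$ denotes the homomorphism induced on fundamental groups. For paths, $\alpha\cdot\beta$ is concatenation and $\alpha^{-}(t)=\alpha(1-t)$. Closed subgroups and closure: for a based space $(\mathbb{T},t_0)$, a subgroup $T\leq\pi_1(\mathbb{T},t_0)$ and $g\in\pi_1(\mathbb{T},t_0)$, a subgroup $H\leq\pi_1(X,x_0)$ of the fundamental group of a based space $(X,x_0)$ is $(T,g)$-closed if for every map $f:(\mathbb{T},t_0)\to(X,x_0)$ with $f_{\#}(T)\leq H$ we have $f_{\#}(g)\in H$. The $(T,g)$-closure $cl_{T,g}(H)$ is the intersection of all $(T,g)$-closed subgroups of $\pi_1(X,x_0)$ containing $H$. The space $\mathbb{H}^+$: let $C_n\subseteq\mathbb{R}^2$ be the circle of radius $\frac1n$ centered at $(\frac1n,0)$, $\mathbb{H}=\bigcup_{n\geq1}C_n$, $b_0=(0,0)$, and $\mathbb{H}^+=\mathbb{H}\cup([-1,0]\times\{0\})$ with basepoint $b_0^+=(-1,0)$. Let $\ell_n$ be the loop based at $b_0$ traversing $C_n$ once counterclockwise and $\iota:[0,1]\to\mathbb{H}^+$, $\iota(t)=(t-1,0)$. Let $\mathcal{C}\subseteq[0,1]$ be the standard middle third Cantor set and write $[0,1]\setminus\mathcal{C}=\bigcup_{n\geq1}\bigcup_{k=1}^{2^{n-1}}I_n^k$, where $I_n^k$ are the components of length $\frac{1}{3^n}$, indexed by $k$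 in their natural order. Let $\ell_\tau:[0,1]\to\mathbb{H}$ be the loop with $\ell_\tau(\mathcal{C})=\{b_0\}$ and equal to $\ell_{2^{n-1}+k-1}$ (linearly reparametrized) on $\overline{I_n^k}$. Put $c_n=[\iota\cdot\ell_n\cdot\iota^{-}]$, $C=\langle c_n\mid n\in\mathbb{N}\rangle\leq\pi_1(\mathbb{H}^+,b_0^+)$, $c_\tau=[\iota\cdot\ell_\tau\cdot\iota^{-}]$. Let $f_{odd},f_{even}:\mathbb{H}\to\mathbb{H}$ be the maps with $f_{odd}\circ\ell_n=\ell_{2n-1}$ and $f_{even}\circ\ell_n=\ell_{2n}$. Put $p_n=[\iota\cdot\ell_{2n-1}\cdot\ell_{2n}^{-}\cdot\iota^{-}]$, $P=\langle p_n\mid n\in\mathbb{N}\rangle\leq\pi_1(\mathbb{H}^+,b_0^+)$, and $p_\tau=[\iota\cdot(f_{odd}\circ\ell_\tau)\cdot(f_{even}\circ\ell_\tau)^{-}\cdot\iota^{-}]$. *)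

theory Defs
  imports "HOL-Analysis.Analysis" "HOL-Algebra.Generated_Groups"
begin

section \<open>Fundamental group and closed subgroups\<close>

text \<open>Spaces are subsets of a topological space type, paths are taken on \<open>[0,1]\<close> and only
  their values there matter.\<close>

definition path_class :: "'a::topological_space set \<Rightarrow> (real \<Rightarrow> 'a) \<Rightarrow> (real \<Rightarrow> 'a) set" where
  "path_class X p = {q. homotopic_paths X p q}"

definition loops_at :: "'a::topological_space set \<Rightarrow> 'a \<Rightarrow> (real \<Rightarrow> 'a) set" where
  "loops_at X x0 = {p. path p \<and> path_image p \<subseteq> X \<and> pathstart p = x0 \<and> pathfinish p = x0}"

definition fundamental_group :: "'a::topological_space set \<Rightarrow> 'a \<Rightarrow> (real \<Rightarrow> 'a) set monoid" where
  "fundamental_group X x0 =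
     \<lparr>carrier = path_class X ` loops_at X x0,
      mult = (\<lambda>A B. {r. \<exists>p\<in>A. \<exists>q\<in>B. homotopic_paths X (p +++ q) r}),
      one = path_class X (\<lambda>_. x0)\<rparr>"

text \<open>For \<open>f : S \<rightarrow> X\<close> the homomorphism sending the class of \<open>p\<close> in \<open>S\<close> to the class of
  \<open>f \<circ> p\<close> in \<open>X\<close>; see \<open>induced_hom_class\<close> below.\<close>

definition induced_hom ::
    "'b::topological_space set \<Rightarrow> ('a::topological_space \<Rightarrow> 'b) \<Rightarrow> (real \<Rightarrow> 'a) set \<Rightarrow> (real \<Rightarrow> 'b) set" where
  "induced_hom X f A = {q. \<exists>p\<in>A. homotopic_paths X (f \<circ> p) q}"

definition based_map ::
    "'a::topological_space set \<Rightarrow> 'a \<Rightarrow> 'b::topological_space set \<Rightarrow> 'b \<Rightarrow> ('a \<Rightarrow> 'b) \<Rightarrow> bool" where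
  "based_map S s0 X x0 f \<longleftrightarrow> continuous_on S f \<and> f ` S \<subseteq> X \<and> f s0 = x0"

text \<open>The test space is \<open>(S, s0)\<close>, with subgroup \<open>T\<close> and element \<open>g\<close> of its fundamental group.\<close>

definition closed_subgroup ::
    "'a::topological_space set \<Rightarrow> 'a \<Rightarrow> (real \<Rightarrow> 'a) set set \<Rightarrow> (real \<Rightarrow> 'a) set \<Rightarrow>
     'b::topological_space set \<Rightarrow> 'b \<Rightarrow> (real \<Rightarrow> 'b) set set \<Rightarrow> bool" where
  "closed_subgroup S s0 T g X x0 H \<longleftrightarrow>
     subgroup H (fundamental_group X x0) \<and>
     (\<forall>f. based_map S s0 X x0 f \<and> induced_hom X f ` T \<subseteq> H \<longrightarrow> induced_hom X f g \<in> H)"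

definition subgroup_closure ::
    "'a::topological_space set \<Rightarrow> 'a \<Rightarrow> (real \<Rightarrow> 'a) set set \<Rightarrow> (real \<Rightarrow> 'a) set \<Rightarrow>
     'b::topological_space set \<Rightarrow> 'b \<Rightarrow> (real \<Rightarrow> 'b) set set \<Rightarrow> (real \<Rightarrow> 'b) set set" where
  "subgroup_closure S s0 T g X x0 H = \<Inter>{K. closed_subgroup S s0 T g X x0 K \<and> H \<subseteq> K}"


section \<open>The Hawaiian earring with a whisker\<close>

text \<open>The plane is \<^typ>\<open>complex\<close>. Circles and their loops are indexed by \<open>n \<ge> 1\<close>.\<close>

definition earring_circle :: "nat \<Rightarrow> complex set" where
  "earring_circle n = sphere (1 / of_nat n) (1 / of_nat n)"

definition earring :: "complex set" where
  "earring = (\<Union>n\<in>{1..}. earring_circle n)"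

definition earring_plus :: "complex set" where
  "earring_plus = earring \<union> of_real ` {-1..0}"

definition base_plus :: complex where
  "base_plus = -1"

definition whisker :: "real \<Rightarrow> complex" where
  "whisker t = of_real (t - 1)"

definition ell :: "nat \<Rightarrow> real \<Rightarrow> complex" where
  "ell n t = (1 - exp (2 * of_real pi * \<i> * of_real t)) / of_nat n"

text \<open>On \<open>earring\<close>, this maps the \<open>n\<close>-th circle onto the \<open>\<phi> n\<close>-th one by scaling. The circle of
  \<open>z\<close> is unique except for \<open>z = 0\<close>, where the scaling factor does not matter.\<close>

definition reindex_map :: "(nat \<Rightarrow> nat) \<Rightarrow> complex \<Rightarrow> complex" where
  "reindex_map \<phi> z =
     (let n = (SOME n. 1 \<le> n \<and> z \<in> earring_circle n) in of_nat n / of_nat (\<phi> n) * z)"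

definition f_odd :: "complex \<Rightarrow> complex" where
  "f_odd = reindex_map (\<lambda>n. 2 * n - 1)"

definition f_even :: "complex \<Rightarrow> complex" where
  "f_even = reindex_map (\<lambda>n. 2 * n)"


section \<open>The Cantor set and the loop over its gaps\<close>

primrec cantor_stage :: "nat \<Rightarrow> real set" where
  "cantor_stage 0 = {0..1}"
| "cantor_stage (Suc n) = (\<lambda>x. x / 3) ` cantor_stage n \<union> (\<lambda>x. 2 / 3 + x / 3) ` cantor_stage n"

definition cantor_set :: "real set" where
  "cantor_set = (\<Inter>n. cantor_stage n)"

definition cantor_gaps :: "nat \<Rightarrow> real set set" where
  "cantor_gaps n = {I \<in> components ({0..1} - cantor_set). Sup I - Inf I = 1 / 3 ^ n}"

text \<open>A component \<open>I\<close> is the interval \<open>I\<^sub>n\<^sup>k\<close> for \<open>n = gap_level I\<close> and \<open>k = gap_rank I\<close>; ranks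
  start at 1.\<close>

definition gap_level :: "real set \<Rightarrow> nat" where
  "gap_level I = (THE n. I \<in> cantor_gaps n)"

definition gap_rank :: "real set \<Rightarrow> nat" where
  "gap_rank I = card {J \<in> cantor_gaps (gap_level I). Inf J \<le> Inf I}"

definition ell_tau :: "real \<Rightarrow> complex" where
  "ell_tau t =
     (if t \<in> {0..1} - cantor_set then
        let I = connected_component_set ({0..1} - cantor_set) t
        in ell (2 ^ (gap_level I - 1) + gap_rank I - 1) ((t - Inf I) / (Sup I - Inf I))
      else 0)"


section \<open>The elements and subgroups\<close>

definition c_elem :: "nat \<Rightarrow> (real \<Rightarrow> complex) set" where
  "c_elem n = path_class earring_plus (whisker +++ ell n +++ reversepath whisker)"

definition c_subgroup :: "(real \<Rightarrow> complex) set set" where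
  "c_subgroup = generate (fundamental_group earring_plus base_plus) (c_elem ` {1..})"

definition c_tau :: "(real \<Rightarrow> complex) set" where
  "c_tau = path_class earring_plus (whisker +++ ell_tau +++ reversepath whisker)"

definition p_elem :: "nat \<Rightarrow> (real \<Rightarrow> complex) set" where
  "p_elem n = path_class earring_plus
     (whisker +++ ell (2 * n - 1) +++ reversepath (ell (2 * n)) +++ reversepath whisker)"

definition p_subgroup :: "(real \<Rightarrow> complex) set set" where
  "p_subgroup = generate (fundamental_group earring_plus base_plus) (p_elem ` {1..})"

definition p_tau :: "(real \<Rightarrow> complex) set" where
  "p_tau = path_class earring_plus
     (whisker +++ (f_odd \<circ> ell_tau) +++ reversepath (f_even \<circ> ell_tau) +++ reversepath whisker)"


section \<open>Well-definedness of the fundamental group\<close>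

lemma loops_at_class_eq_iff:
  assumes "p \<in> loops_at X x0"
  shows "path_class X p = path_class X q \<longleftrightarrow> homotopic_paths X p q"
proof
  assume "path_class X p = path_class X q"
  moreover have "p \<in> path_class X p"
    using assms by (auto simp: path_class_def loops_at_def)
  ultimately show "homotopic_paths X p q"
    using homotopic_paths_sym by (auto simp: path_class_def)
next
  assume "homotopic_paths X p q"
  then show "path_class X p = path_class X q"
    unfolding path_class_def using homotopic_paths_trans homotopic_paths_sym by blast
qed

lemma mult_path_class:
  assumes "p \<in> loops_at X x0" "q \<in> loops_at X x0"
  shows "path_class X p \<otimes>\<^bsub>fundamental_group X x0\<^esub> path_class X q = path_class X (p +++ q)"
proof -
  have "homotopic_paths X (p +++ q) (p' +++ q')"
    if "homotopic_paths X p p'" "homotopic_paths X q q'" for p' q'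
    using homotopic_paths_join[OF that] assms by (simp add: loops_at_def)
  moreover have "homotopic_paths X p p" "homotopic_paths X q q"
    using assms by (auto simp: loops_at_def)
  ultimately have "(\<exists>p'\<in>path_class X p. \<exists>q'\<in>path_class X q. homotopic_paths X (p' +++ q') r)
      \<longleftrightarrow> homotopic_paths X (p +++ q) r" for r
    unfolding path_class_def mem_Collect_eq Bex_def by (meson homotopic_paths_trans)
  then show ?thesis
    by (simp add: fundamental_group_def) (simp add: path_class_def)
qed

lemma induced_hom_class:
  assumes "based_map S s0 X x0 f" "p \<in> loops_at S s0"
  shows "induced_hom X f (path_class S p) = path_class X (f \<circ> p)"
proof -
  have "homotopic_paths X (f \<circ> p) (f \<circ> p')" if "homotopic_paths S p p'" for p'
    using homotopic_paths_continuous_image[OF that] assms by (auto simp: based_map_def)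
  moreover have "homotopic_paths S p p"
    using assms by (auto simp: loops_at_def)
  ultimately have "(\<exists>p'\<in>path_class S p. homotopic_paths X (f \<circ> p') r) \<longleftrightarrow> homotopic_paths X (f \<circ> p) r" for r
    unfolding path_class_def mem_Collect_eq Bex_def by (meson homotopic_paths_trans)
  then show ?thesis
    by (simp add: induced_hom_def) (simp add: path_class_def)
qed

lemma loops_at_join: "p \<in> loops_at X x0 \<Longrightarrow> q \<in> loops_at X x0 \<Longrightarrow> p +++ q \<in> loops_at X x0"
  by (auto simp: loops_at_def path_image_join)

lemma group_fundamental_group:
  assumes "x0 \<in> X"
  shows "group (fundamental_group X x0)"
proof (rule groupI)
  let ?G = "fundamental_group X x0"
  have car: "carrier ?G = path_class X ` loops_at X x0"
    and one: "\<one>\<^bsub>?G\<^esub> = path_class X (\<lambda>_. x0)"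
    by (auto simp: fundamental_group_def)
  have const: "(\<lambda>_. x0) \<in> loops_at X x0"
    using assms by (auto simp: loops_at_def path_def path_image_def pathstart_def pathfinish_def)
  show "x \<otimes>\<^bsub>?G\<^esub> y \<in> carrier ?G" if "x \<in> carrier ?G" "y \<in> carrier ?G" for x y
    using that by (auto simp: car mult_path_class loops_at_join)
  show "\<one>\<^bsub>?G\<^esub> \<in> carrier ?G"
    using const by (auto simp: car one)
  show "(x \<otimes>\<^bsub>?G\<^esub> y) \<otimes>\<^bsub>?G\<^esub> z = x \<otimes>\<^bsub>?G\<^esub> (y \<otimes>\<^bsub>?G\<^esub> z)"
    if xyz: "x \<in> carrier ?G" "y \<in> carrier ?G" "z \<in> carrier ?G" for x y z
  proof -
    from xyz obtain p q r where pqr: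
      "p \<in> loops_at X x0" "q \<in> loops_at X x0" "r \<in> loops_at X x0"
      "x = path_class X p" "y = path_class X q" "z = path_class X r"
      by (auto simp: car)
    have "homotopic_paths X (p +++ (q +++ r)) ((p +++ q) +++ r)"
      by (rule homotopic_paths_assoc) (use pqr in \<open>auto simp: loops_at_def\<close>)
    then show ?thesis
      using pqr by (simp add: mult_path_class loops_at_join)
        (meson loops_at_class_eq_iff loops_at_join const homotopic_paths_sym)
  qed
  show "\<one>\<^bsub>?G\<^esub> \<otimes>\<^bsub>?G\<^esub> x = x" if "x \<in> carrier ?G" for x
  proof -
    from that obtain p where p: "p \<in> loops_at X x0" "x = path_class X p"
      by (auto simp: car)
    have "homotopic_paths X ((\<lambda>_. x0) +++ p) p"
    proof (rule homotopic_paths_sym, rule homotopic_paths_reparametrize)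
      show "continuous_on {0..1::real} (\<lambda>t. max 0 (2 * t - 1))"
        by (intro continuous_intros)
      show "((\<lambda>_. x0) +++ p) t = p (max 0 (2 * t - 1))" if "t \<in> {0..1}" for t
        using that p
        by (cases "2 * t \<le> 1") (auto simp: joinpaths_def loops_at_def pathstart_def max_def)
    qed (use p in \<open>auto simp: loops_at_def\<close>)
    then show ?thesis
      using p const by (simp add: one mult_path_class) (meson loops_at_class_eq_iff loops_at_join const homotopic_paths_sym)
  qed
  show "\<exists>y\<in>carrier ?G. y \<otimes>\<^bsub>?G\<^esub> x = \<one>\<^bsub>?G\<^esub>" if "x \<in> carrier ?G" for x
  proof -
    from that obtain p where p: "p \<in> loops_at X x0" "x = path_class X p"
      by (auto simp: car)
    let ?m = "\<lambda>t::real. max (1 - 2 * t) (2 * t - 1)"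
    let ?h = "\<lambda>y::real\<times>real. p (1 - (1 - fst y) * min (2 * snd y) (2 - 2 * snd y))"
    have rp: "reversepath p \<in> loops_at X x0"
      using p by (auto simp: loops_at_def)
    have range: "1 - (1 - a) * min (2 * b) (2 - 2 * b) \<in> {0..1}" if "a \<in> {0..1}" "b \<in> {0..1}" for a b :: real
    proof -
      have "0 \<le> min (2 * b) (2 - 2 * b)" "min (2 * b) (2 - 2 * b) \<le> 1"
        using that by (auto simp: min_def)
      then show ?thesis
        using that mult_le_one[of "1 - a" "min (2 * b) (2 - 2 * b)"] by simp
    qed
    have "homotopic_paths X (reversepath p +++ p) (\<lambda>_. x0)"
      unfolding homotopic_paths
    proof (intro exI[of _ ?h] conjI ballI)
      have cp: "continuous_on {0..1} p"
        using p by (auto simp: loops_at_def path_def)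
      show "continuous_on ({0..1} \<times> {0..1}) ?h"
        by (rule continuous_on_compose2[OF cp]) (use range in \<open>auto intro!: continuous_intros\<close>)
      show "?h \<in> {0..1} \<times> {0..1} \<rightarrow> X"
        using p range by (fastforce simp: loops_at_def path_image_def)
      show "?h (0, t) = (reversepath p +++ p) t" if "t \<in> {0..1}" for t
        using that by (auto simp: joinpaths_def reversepath_def min_def algebra_simps)
      show "?h (1, t) = x0" if "t \<in> {0..1}" for t
        using p by (auto simp: loops_at_def pathfinish_def)
      show "pathstart (?h \<circ> Pair t) = pathstart (reversepath p +++ p)"
           "pathfinish (?h \<circ> Pair t) = pathfinish (reversepath p +++ p)" for t
        using p by (auto simp: loops_at_def pathfinish_def pathstart_def reversepath_def joinpaths_def)
    qed
    then have "path_class X (reversepath p) \<otimes>\<^bsub>?G\<^esub> x = \<one>\<^bsub>?G\<^esub>"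
      using p rp by (simp add: one mult_path_class) (meson loops_at_class_eq_iff loops_at_join const homotopic_paths_sym)
    then show ?thesis
      using rp by (auto simp: car)
  qed
qed


section \<open>The gaps of the Cantor set\<close>

text \<open>Left end points of the gaps of length \<open>1 / 3 ^ Suc n\<close>.\<close>

primrec gap_left :: "nat \<Rightarrow> real set" where
  "gap_left 0 = {1 / 3}"
| "gap_left (Suc n) = (\<lambda>x. x / 3) ` gap_left n \<union> (\<lambda>x. 2 / 3 + x / 3) ` gap_left n"

definition third_interval :: "nat \<Rightarrow> real \<Rightarrow> real set" where
  "third_interval n a = {a<..<a + 1 / 3 ^ Suc n}"

lemma cantor_stage_subset: "cantor_stage n \<subseteq> {0..1}"
  by (induction n) fastforce+

lemma cantor_stage_ends: "0 \<in> cantor_stage n" "1 \<in> cantor_stage n"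
  by (induction n) (auto simp: image_iff intro: bexI[of _ 0] bexI[of _ 1])

lemma cantor_stage_left:
  assumes "x \<in> {0..1}"
  shows "x / 3 \<in> cantor_stage (Suc n) \<longleftrightarrow> x \<in> cantor_stage n"
proof
  assume "x / 3 \<in> cantor_stage (Suc n)"
  then consider "x \<in> cantor_stage n" | y where "y \<in> cantor_stage n" "x / 3 = 2 / 3 + y / 3"
    by auto
  then show "x \<in> cantor_stage n"
  proof cases
    case 2
    then show ?thesis
      using cantor_stage_subset[of n] assms by auto
  qed
qed auto

lemma cantor_stage_right:
  assumes "x \<in> {0..1}"
  shows "2 / 3 + x / 3 \<in> cantor_stage (Suc n) \<longleftrightarrow> x \<in> cantor_stage n"
proof
  assume "2 / 3 + x / 3 \<in> cantor_stage (Suc n)"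
  then consider "x \<in> cantor_stage n" | y where "y \<in> cantor_stage n" "y / 3 = 2 / 3 + x / 3"
    by auto
  then show "x \<in> cantor_stage n"
  proof cases
    case 2
    then have "y = 2 + x" by simp
    then show ?thesis
      using subsetD[OF cantor_stage_subset 2(1)] assms by auto
  qed
qed auto

lemma cantor_set_left: "x \<in> {0..1} \<Longrightarrow> x / 3 \<in> cantor_set \<longleftrightarrow> x \<in> cantor_set"
proof -
  assume x: "x \<in> {0..1}"
  have "(\<forall>n. x / 3 \<in> cantor_stage n) \<longleftrightarrow> (\<forall>n. x / 3 \<in> cantor_stage (Suc n))"
    using x by (metis atLeastAtMost_iff cantor_stage.simps(1) divide_le_eq_1 divide_nonneg_nonneg not0_implies_Suc
        order_trans one_le_numeral zero_le_numeral zero_less_numeral linorder_not_less)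
  then show ?thesis
    using x cantor_stage_left by (auto simp: cantor_set_def simp del: cantor_stage.simps)
qed

lemma cantor_set_right: "x \<in> {0..1} \<Longrightarrow> 2 / 3 + x / 3 \<in> cantor_set \<longleftrightarrow> x \<in> cantor_set"
proof -
  assume x: "x \<in> {0..1}"
  have "2 / 3 + x / 3 \<in> cantor_stage 0"
    using x by auto
  then have "(\<forall>n. 2 / 3 + x / 3 \<in> cantor_stage n) \<longleftrightarrow> (\<forall>n. 2 / 3 + x / 3 \<in> cantor_stage (Suc n))"
    by (metis not0_implies_Suc)
  then show ?thesis
    using x cantor_stage_right by (auto simp: cantor_set_def simp del: cantor_stage.simps)
qed

lemma cantor_set_ends: "0 \<in> cantor_set" "1 \<in> cantor_set"
  by (auto simp: cantor_set_def cantor_stage_ends)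

lemma cantor_set_middle: "x \<in> {1 / 3<..<2 / 3} \<Longrightarrow> x \<notin> cantor_set"
proof
  assume x: "x \<in> {1 / 3<..<2 / 3}" "x \<in> cantor_set"
  then have "x \<in> cantor_stage (Suc 0)"
    unfolding cantor_set_def by blast
  with x(1) show False
    by auto
qed

lemma gap_left_bounds: "a \<in> gap_left n \<Longrightarrow> 0 < a \<and> a + 1 / 3 ^ Suc n < 1"
proof (induction n arbitrary: a)
  case (Suc n)
  have "1 / 3 ^ Suc (Suc n) = (1 / 3 ^ Suc n) / (3 :: real)" "0 < 1 / (3 ^ Suc n :: real)"
    by auto
  then show ?case
    using Suc by (fastforce simp del: power_Suc)
qed auto

lemma gap_left_in_01:
  assumes "a \<in> gap_left n"
  shows "a \<in> {0..1}" "a + 1 / 3 ^ Suc n \<in> {0..1}"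
proof -
  have "0 < 1 / (3::real) ^ Suc n"
    by simp
  then show "a \<in> {0..1}" "a + 1 / 3 ^ Suc n \<in> {0..1}"
    using gap_left_bounds[OF assms] unfolding atLeastAtMost_iff by linarith+
qed

lemma third_power_eq_iff: "1 / (3::real) ^ m = 1 / 3 ^ n \<longleftrightarrow> m = n"
  by (metis divide_cancel_left numeral_eq_one_iff one_less_numeral_iff power_inject_exp semiring_norm(77,86) zero_neq_one)

lemma scale_third_bounds:
  fixes b d x :: real
  shows "b / 3 < x \<Longrightarrow> x < (b + d) / 3 \<Longrightarrow> b < 3 * x \<and> 3 * x < b + d"
    and "2 / 3 + b / 3 < x \<Longrightarrow> x < 2 / 3 + (b + d) / 3 \<Longrightarrow> b < 3 * x - 2 \<and> 3 * x - 2 < b + d"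
  by (auto simp: field_simps)

lemma gap_left_third_interval:
  assumes "a \<in> gap_left n"
  shows "a \<in> cantor_set \<and> a + 1 / 3 ^ Suc n \<in> cantor_set \<and> third_interval n a \<inter> cantor_set = {}"
  using assms
proof (induction n arbitrary: a)
  case 0
  have "1 / 3 \<in> cantor_set" "2 / 3 \<in> cantor_set"
    using cantor_set_left[of 1] cantor_set_right[of 0] cantor_set_ends by auto
  moreover have "a = 1 / 3" "a + 1 / 3 ^ Suc 0 = 2 / 3" "third_interval 0 a = {1 / 3<..<2 / 3}"
    using 0 by (auto simp: third_interval_def)
  moreover have "{1 / 3<..<2 / 3} \<inter> cantor_set = {}"
    using cantor_set_middle by blast
  ultimately show ?case
    by presburger
next
  case (Suc n)
  from Suc.prems consider (left) b where "b \<in> gap_left n" "a = b / 3"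
    | (right) b where "b \<in> gap_left n" "a = 2 / 3 + b / 3"
    by auto
  then show ?case
  proof cases
    case left
    note IH = Suc.IH[OF left(1)] and bd = gap_left_bounds[OF left(1)]
    have eq: "a + 1 / 3 ^ Suc (Suc n) = (b + 1 / 3 ^ Suc n) / 3"
      by (simp add: left field_simps)
    have "x \<notin> cantor_set" if "x \<in> third_interval (Suc n) a" for x
    proof -
      have "3 * x \<in> third_interval n b"
      proof -
        have "a < x" "x < a + 1 / 3 ^ Suc (Suc n)"
          using that by (simp_all add: third_interval_def del: power_Suc)
        then show ?thesis
          unfolding third_interval_def greaterThanLessThan_iff eq unfolding left(2)
          by (rule scale_third_bounds(1))
      qed
      moreover from this have "3 * x \<in> {0..1}"
        using bd by (auto simp: third_interval_def simp del: power_Suc)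
      ultimately show ?thesis
        using IH cantor_set_left[of "3 * x"] by auto
    qed
    moreover have "b \<in> {0..1}" "b + 1 / 3 ^ Suc n \<in> {0..1}"
      using gap_left_in_01 left(1) by blast+
    ultimately show ?thesis
      using IH cantor_set_left unfolding eq by (auto simp: left simp del: power_Suc)
  next
    case right
    note IH = Suc.IH[OF right(1)] and bd = gap_left_bounds[OF right(1)]
    have eq: "a + 1 / 3 ^ Suc (Suc n) = 2 / 3 + (b + 1 / 3 ^ Suc n) / 3"
      by (simp add: right field_simps)
    have "x \<notin> cantor_set" if "x \<in> third_interval (Suc n) a" for x
    proof -
      have "3 * x - 2 \<in> third_interval n b"
      proof -
        have "a < x" "x < a + 1 / 3 ^ Suc (Suc n)"
          using that by (simp_all add: third_interval_def del: power_Suc)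
        then show ?thesis
          unfolding third_interval_def greaterThanLessThan_iff eq unfolding right(2)
          by (rule scale_third_bounds(2))
      qed
      moreover from this have "3 * x - 2 \<in> {0..1}"
        using bd by (auto simp: third_interval_def simp del: power_Suc)
      moreover have "2 / 3 + (3 * x - 2) / 3 = x"
        by (simp add: field_simps)
      ultimately show ?thesis
        using IH cantor_set_right[of "3 * x - 2"] by auto
    qed
    moreover have "b \<in> {0..1}" "b + 1 / 3 ^ Suc n \<in> {0..1}"
      using gap_left_in_01 right(1) by blast+
    ultimately show ?thesis
      using IH cantor_set_right unfolding eq by (auto simp: right simp del: power_Suc)
  qed
qed

lemma not_cantor_stage_third_interval:
  assumes "x \<in> {0..1} - cantor_stage m"
  shows "\<exists>n. \<exists>a\<in>gap_left n. x \<in> third_interval n a"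
  using assms
proof (induction m arbitrary: x)
  case (Suc m)
  consider "x < 1 / 3 \<or> x = 1 / 3" | "x = 2 / 3 \<or> 2 / 3 < x" | "1 / 3 < x" "x < 2 / 3"
    by linarith
  then show ?case
  proof cases
    case 1
    then have "3 * x \<in> {0..1}" "3 * x \<notin> cantor_stage m"
      using Suc.prems cantor_stage_left[of "3 * x" m] by (auto simp del: cantor_stage.simps)
    then obtain n a where na: "a \<in> gap_left n" "3 * x \<in> third_interval n a"
      using Suc.IH by blast
    then have "x \<in> third_interval (Suc n) (a / 3)"
      by (auto simp: third_interval_def)
    moreover have "a / 3 \<in> gap_left (Suc n)"
      using na by auto
    ultimately show ?thesis
      by blast
  next
    case 2
    then have "3 * x - 2 \<in> {0..1}"
      using Suc.prems by auto
    moreover have e: "2 / 3 + (3 * x - 2) / 3 = x"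
      by (simp add: field_simps)
    ultimately have "3 * x - 2 \<in> {0..1}" "3 * x - 2 \<notin> cantor_stage m"
      using Suc.prems cantor_stage_right[of "3 * x - 2" m] unfolding e
      by (auto simp del: cantor_stage.simps)
    then obtain n a where na: "a \<in> gap_left n" "3 * x - 2 \<in> third_interval n a"
      using Suc.IH by blast
    then have "x \<in> third_interval (Suc n) (2 / 3 + a / 3)"
      by (auto simp: third_interval_def)
    moreover have "2 / 3 + a / 3 \<in> gap_left (Suc n)"
      using na by auto
    ultimately show ?thesis
      by blast
  next
    case 3
    then have "x \<in> third_interval 0 (1 / 3)"
      by (auto simp: third_interval_def)
    then show ?thesis
      by (intro exI[of _ 0]) auto
  qed
qed auto

lemma third_interval_component:
  assumes a: "a \<in> gap_left n" and x: "x \<in> third_interval n a"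
  shows "connected_component_set ({0..1} - cantor_set) x = third_interval n a"
proof (rule connected_component_unique)
  note bd = gap_left_bounds[OF a] and ti = gap_left_third_interval[OF a]
  show "x \<in> third_interval n a"
    by (fact x)
  show "connected (third_interval n a)"
    by (auto simp: third_interval_def)
  show "third_interval n a \<subseteq> {0..1} - cantor_set"
    using bd ti by (auto simp: third_interval_def)
  fix U
  assume U: "x \<in> U" "U \<subseteq> {0..1} - cantor_set" "connected U"
  show "U \<subseteq> third_interval n a"
  proof
    fix y
    assume y: "y \<in> U"
    have "a < y"
      using U y ti x connectedD_interval[OF U(3) y U(1), of a]
      by (force simp: third_interval_def)
    moreover have "y < a + 1 / 3 ^ Suc n"
      using U y ti x connectedD_interval[OF U(3) U(1) y, of "a + 1 / 3 ^ Suc n"]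
      by (force simp: third_interval_def)
    ultimately show "y \<in> third_interval n a"
      by (auto simp: third_interval_def)
  qed
qed

lemma in_third_interval_iff:
  "x \<in> {0..1} - cantor_set \<longleftrightarrow> (\<exists>n. \<exists>a\<in>gap_left n. x \<in> third_interval n a)"
proof
  assume "\<exists>n. \<exists>a\<in>gap_left n. x \<in> third_interval n a"
  then obtain n a where *: "a \<in> gap_left n" "x \<in> third_interval n a"
    by blast
  then have "0 \<le> x \<and> x \<le> 1"
    using gap_left_bounds[of a n] by (auto simp: third_interval_def simp del: power_Suc)
  then show "x \<in> {0..1} - cantor_set"
    using gap_left_third_interval[of a n] * by auto
next
  assume "x \<in> {0..1} - cantor_set"
  then show "\<exists>n. \<exists>a\<in>gap_left n. x \<in> third_interval n a"
    using not_cantor_stage_third_interval unfolding cantor_set_def by blast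
qed

lemma third_interval_ends:
  "Inf (third_interval n a) = a" "Sup (third_interval n a) = a + 1 / 3 ^ Suc n"
  "third_interval n a \<noteq> {}"
proof -
  have less: "a < a + 1 / 3 ^ Suc n"
    by simp
  then show "Inf (third_interval n a) = a" "Sup (third_interval n a) = a + 1 / 3 ^ Suc n"
    "third_interval n a \<noteq> {}"
    unfolding third_interval_def greaterThanLessThan_empty_iff
    by (simp_all only: cInf_greaterThanLessThan cSup_greaterThanLessThan not_le)
qed

lemma components_cantor:
  "components ({0..1} - cantor_set) = (\<Union>n. third_interval n ` gap_left n)"
proof (intro Set.set_eqI iffI)
  fix I
  assume "I \<in> components ({0..1} - cantor_set)"
  then obtain x where x: "x \<in> {0..1} - cantor_set"
    and I: "I = connected_component_set ({0..1} - cantor_set) x"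
    unfolding components_iff by blast
  from x obtain n a where "a \<in> gap_left n" "x \<in> third_interval n a"
    unfolding in_third_interval_iff by blast
  then show "I \<in> (\<Union>n. third_interval n ` gap_left n)"
    using third_interval_component[of a n x] I by blast
next
  fix I
  assume "I \<in> (\<Union>n. third_interval n ` gap_left n)"
  then obtain n a where na: "a \<in> gap_left n" "I = third_interval n a"
    by blast
  obtain x where x: "x \<in> third_interval n a"
    using third_interval_ends(3)[of n a] by blast
  then have "x \<in> {0..1} - cantor_set"
    using na(1) unfolding in_third_interval_iff by blast
  then show "I \<in> components ({0..1} - cantor_set)"
    unfolding components_iff na(2) third_interval_component[OF na(1) x, symmetric] by blast
qed

lemma cantor_gaps_0: "cantor_gaps 0 = {}"
proof -
  have "1 / 3 ^ Suc n \<noteq> (1::real)" for n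
    using third_power_eq_iff[of "Suc n" 0] by simp
  then show ?thesis
    unfolding cantor_gaps_def components_cantor
    by (auto simp: third_interval_ends simp del: power_Suc)
qed

lemma cantor_gaps_Suc: "cantor_gaps (Suc n) = third_interval n ` gap_left n"
proof (intro Set.set_eqI iffI)
  fix I
  assume "I \<in> cantor_gaps (Suc n)"
  then obtain m a where "a \<in> gap_left m" "I = third_interval m a"
    and eq: "Sup I - Inf I = 1 / 3 ^ Suc n"
    unfolding cantor_gaps_def components_cantor by blast
  moreover from this have "1 / 3 ^ Suc m = (1::real) / 3 ^ Suc n"
    by (simp add: third_interval_ends del: power_Suc)
  then have "m = n"
    by (metis third_power_eq_iff old.nat.inject)
  ultimately show "I \<in> third_interval n ` gap_left n"
    by blast
next
  fix I
  assume "I \<in> third_interval n ` gap_left n"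
  then show "I \<in> cantor_gaps (Suc n)"
    unfolding cantor_gaps_def components_cantor
    by (auto simp: third_interval_ends simp del: power_Suc)
qed

lemma inj_third_interval: "inj_on (third_interval n) A"
  by (metis inj_onI third_interval_ends(1))

lemma card_gap_left: "card (gap_left n) = 2 ^ n" and finite_gap_left: "finite (gap_left n)"
proof (induction n)
  case (Suc n)
  have "0 < x \<and> x < 1" if "x \<in> gap_left n" for x
  proof -
    have "0 < 1 / (3::real) ^ Suc n"
      by simp
    then show ?thesis
      using gap_left_bounds[OF that] by linarith
  qed
  then have "(\<lambda>x. x / 3) ` gap_left n \<inter> (\<lambda>x. 2 / 3 + x / 3) ` gap_left n = {}"
  proof (intro equals0I)
    fix z
    assume "\<And>x. x \<in> gap_left n \<Longrightarrow> 0 < x \<and> x < 1"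
      and "z \<in> (\<lambda>x. x / 3) ` gap_left n \<inter> (\<lambda>x. 2 / 3 + x / 3) ` gap_left n"
    then obtain x y where "x < 1" "0 < y" "z = x / 3" "z = 2 / 3 + y / 3"
      by blast
    then show False
      by simp
  qed
  moreover have "inj_on (\<lambda>x. x / 3) (gap_left n)" "inj_on (\<lambda>x. 2 / 3 + x / 3) (gap_left n)"
    by (auto simp: inj_on_def)
  ultimately show "card (gap_left (Suc n)) = 2 ^ Suc n"
    using Suc by (simp add: card_Un_disjoint card_image)
qed auto

lemma card_cantor_gaps: "card (cantor_gaps (Suc n)) = 2 ^ n"
  by (simp add: cantor_gaps_Suc card_image inj_third_interval card_gap_left)

lemma gap_level_third_interval:
  assumes "a \<in> gap_left n"
  shows "gap_level (third_interval n a) = Suc n"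
  unfolding gap_level_def
proof (rule the_equality)
  show "third_interval n a \<in> cantor_gaps (Suc n)"
    using assms by (simp add: cantor_gaps_Suc)
  show "m = Suc n" if "third_interval n a \<in> cantor_gaps m" for m
  proof -
    have "1 / 3 ^ Suc n = (1::real) / 3 ^ m"
      using that by (simp add: cantor_gaps_def third_interval_ends del: power_Suc)
    then show ?thesis
      by (metis third_power_eq_iff)
  qed
qed

lemma gap_rank_third_interval:
  assumes "a \<in> gap_left n"
  shows "gap_rank (third_interval n a) = card {b \<in> gap_left n. b \<le> a}"
    "1 \<le> gap_rank (third_interval n a)" "gap_rank (third_interval n a) \<le> 2 ^ n"
proof -
  have "{J \<in> cantor_gaps (Suc n). Inf J \<le> a} = third_interval n ` {b \<in> gap_left n. b \<le> a}"
    by (auto simp: cantor_gaps_Suc third_interval_ends)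
  then show eq: "gap_rank (third_interval n a) = card {b \<in> gap_left n. b \<le> a}"
    using assms by (simp add: gap_rank_def gap_level_third_interval third_interval_ends
        card_image inj_third_interval)
  have "{b \<in> gap_left n. b \<le> a} \<noteq> {}"
    using assms by auto
  then show "1 \<le> gap_rank (third_interval n a)"
    unfolding eq using finite_gap_left by (simp add: Suc_le_eq card_gt_0_iff)
  have "card {b \<in> gap_left n. b \<le> a} \<le> card (gap_left n)"
    by (intro card_mono finite_gap_left) auto
  then show "gap_rank (third_interval n a) \<le> 2 ^ n"
    unfolding eq by (simp add: card_gap_left)
qed


section \<open>Well-definedness of the loops\<close>

lemma ell_ends [simp]: "ell n 0 = 0" "ell n 1 = 0"
  by (simp_all add: ell_def exp_two_pi_i)

lemma ell_continuous: "continuous_on A (ell n)"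
  unfolding ell_def divide_inverse by (intro continuous_intros)

lemma ell_in_circle: "ell n t \<in> earring_circle n"
proof -
  have "1 / of_nat n - ell n t = exp (\<i> * of_real (2 * pi * t)) / of_nat n"
    by (simp add: ell_def diff_divide_distrib mult_ac)
  then show ?thesis
    by (simp add: earring_circle_def dist_norm norm_divide del: of_real_mult)
qed

lemma earring_circle_subset: "1 \<le> n \<Longrightarrow> earring_circle n \<subseteq> earring"
  by (auto simp: earring_def)

lemma ell_in_earring: "1 \<le> n \<Longrightarrow> ell n t \<in> earring"
  using ell_in_circle earring_circle_subset by blast

lemma zero_in_earring: "0 \<in> earring"
  using ell_in_earring[of 1 0] by simp

lemma norm_ell_eq: "norm (ell n t) = 2 * \<bar>sin (pi * t)\<bar> / n"
proof -
  have "norm (exp (\<i> * of_real (2 * pi * t)) - 1) = 2 * \<bar>sin (2 * pi * t / 2)\<bar>"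
    by (rule dist_exp_i_1)
  moreover have "ell n t = - ((exp (\<i> * of_real (2 * pi * t)) - 1) / of_nat n)"
    by (simp add: ell_def diff_divide_distrib mult_ac)
  ultimately show ?thesis
    by (simp add: norm_divide del: of_real_mult)
qed

lemma norm_ell_le: "norm (ell n t) \<le> 2 / n"
  unfolding norm_ell_eq by (intro divide_right_mono) auto

lemma norm_ell_le_start: "1 \<le> n \<Longrightarrow> norm (ell n t) \<le> 2 * pi * \<bar>t\<bar>"
proof -
  assume "1 \<le> n"
  have "\<bar>sin (pi * t)\<bar> \<le> pi * \<bar>t\<bar>"
    using abs_sin_x_le_abs_x[of "pi * t"] by (simp add: abs_mult)
  then have "2 * \<bar>sin (pi * t)\<bar> / n \<le> (2 * pi * \<bar>t\<bar>) / 1"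
    using \<open>1 \<le> n\<close> by (intro frac_le) auto
  then show ?thesis
    by (simp add: norm_ell_eq)
qed

lemma norm_ell_le_end: "1 \<le> n \<Longrightarrow> norm (ell n t) \<le> 2 * pi * \<bar>1 - t\<bar>"
proof -
  assume "1 \<le> n"
  have "norm (ell n t) = norm (ell n (1 - t))"
    by (simp add: norm_ell_eq right_diff_distrib)
  then show ?thesis
    using norm_ell_le_start[OF \<open>1 \<le> n\<close>, of "1 - t"] by simp
qed

lemma ell_tau_cantor: "t \<in> cantor_set \<Longrightarrow> ell_tau t = 0"
  by (simp add: ell_tau_def)

lemma ell_tau_gap:
  assumes "a \<in> gap_left n" "t \<in> third_interval n a"
  shows "ell_tau t = ell (2 ^ n + gap_rank (third_interval n a) - 1) ((t - a) * 3 ^ Suc n)"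
proof -
  have "t \<in> {0..1} - cantor_set"
    using assms in_third_interval_iff by blast
  then show ?thesis
    unfolding ell_tau_def Let_def third_interval_component[OF assms]
    by (simp only: if_True third_interval_ends gap_level_third_interval[OF assms(1)]) simp
qed

text \<open>The closed gap, as in the definition of \<open>\<ell>\<^sub>\<tau>\<close>.\<close>

lemma ell_tau_closed_gap:
  assumes "a \<in> gap_left n" "t \<in> {a..a + 1 / 3 ^ Suc n}"
  shows "ell_tau t = ell (2 ^ n + gap_rank (third_interval n a) - 1) ((t - a) * 3 ^ Suc n)"
proof -
  consider "t = a" | "t = a + 1 / 3 ^ Suc n" | "t \<in> third_interval n a"
    using assms unfolding third_interval_def by force
  then show ?thesis
  proof cases
    case 1
    then show ?thesis
      using gap_left_third_interval[OF assms(1)] by (simp add: ell_tau_cantor)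
  next
    case 2
    then have "(t - a) * 3 ^ Suc n = 1"
      by simp
    then show ?thesis
      using gap_left_third_interval[OF assms(1)] ell_tau_cantor unfolding 2
      by (metis ell_ends(2))
  qed (use assms ell_tau_gap in blast)
qed

lemma gap_index_bounds:
  assumes "a \<in> gap_left n"
  shows "Suc n \<le> 2 ^ n + gap_rank (third_interval n a) - 1"
proof -
  have "Suc n \<le> 2 ^ n"
    by (simp add: Suc_leI)
  then show ?thesis
    using gap_rank_third_interval(2)[OF assms] by linarith
qed

lemma ell_tau_in_earring: "ell_tau t \<in> earring"
proof (cases "t \<in> {0..1} - cantor_set")
  case True
  then obtain n a where na: "a \<in> gap_left n" "t \<in> third_interval n a"
    unfolding in_third_interval_iff by blast
  show ?thesis
    unfolding ell_tau_gap[OF na] using gap_index_bounds[OF na(1)] by (intro ell_in_earring) linarith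
next
  case False
  then show ?thesis
    using zero_in_earring by (simp only: ell_tau_def if_False)
qed

lemma norm_ell_tau_le:
  assumes t: "t \<in> cantor_set" and s: "s \<in> {0..1}"
  shows "norm (ell_tau s) \<le> 2 / Suc N \<or> norm (ell_tau s) \<le> 2 * pi * 3 ^ Suc N * \<bar>s - t\<bar>"
proof (cases "s \<in> cantor_set")
  case True
  then show ?thesis
    by (simp add: ell_tau_cantor)
next
  case False
  then have "s \<in> {0..1} - cantor_set"
    using s by blast
  then obtain n a where na: "a \<in> gap_left n" "s \<in> third_interval n a"
    unfolding in_third_interval_iff by blast
  define m where "m = 2 ^ n + gap_rank (third_interval n a) - 1"
  define u where "u = (s - a) * 3 ^ Suc n"
  have m: "Suc n \<le> m" "1 \<le> m"
    using gap_index_bounds[OF na(1)] by (auto simp: m_def)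
  have eq: "ell_tau s = ell m u"
    unfolding ell_tau_gap[OF na] by (simp add: m_def u_def)
  show ?thesis
  proof (cases "N \<le> n")
    case True
    have "norm (ell m u) \<le> 2 / m"
      by (rule norm_ell_le)
    also have "\<dots> \<le> 2 / Suc N"
      using m True by (intro divide_left_mono) (auto simp del: of_nat_Suc)
    finally show ?thesis
      by (simp add: eq)
  next
    case False
    have sa: "a < s" "s < a + 1 / 3 ^ Suc n"
      using na(2) by (simp_all add: third_interval_def del: power_Suc)
    have pos: "0 < (3::real) ^ Suc n"
      by simp
    have "t \<notin> third_interval n a"
      using gap_left_third_interval[OF na(1)] t by blast
    then consider "t \<le> a" | "a + 1 / 3 ^ Suc n \<le> t"
      by (force simp: third_interval_def not_less simp del: power_Suc)
    then have "norm (ell m u) \<le> 2 * pi * (\<bar>s - t\<bar> * 3 ^ Suc n)"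
    proof cases
      case 1
      then have "\<bar>u\<bar> \<le> \<bar>s - t\<bar> * 3 ^ Suc n"
        unfolding u_def abs_mult using sa pos by (intro mult_mono) auto
      then have "2 * pi * \<bar>u\<bar> \<le> 2 * pi * (\<bar>s - t\<bar> * 3 ^ Suc n)"
        by (intro mult_left_mono) auto
      then show ?thesis
        using norm_ell_le_start[OF m(2), of u] by linarith
    next
      case 2
      have "1 - u = (a + 1 / 3 ^ Suc n - s) * 3 ^ Suc n"
        by (simp add: u_def algebra_simps)
      then have "\<bar>1 - u\<bar> = \<bar>a + 1 / 3 ^ Suc n - s\<bar> * 3 ^ Suc n"
        by (simp only: abs_mult abs_of_pos[OF pos])
      also have "\<dots> \<le> \<bar>s - t\<bar> * 3 ^ Suc n"
        using sa 2 pos by (intro mult_right_mono) linarith+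
      finally have "2 * pi * \<bar>1 - u\<bar> \<le> 2 * pi * (\<bar>s - t\<bar> * 3 ^ Suc n)"
        by (intro mult_left_mono) auto
      then show ?thesis
        using norm_ell_le_end[OF m(2), of u] by linarith
    qed
    also have "\<dots> \<le> 2 * pi * (\<bar>s - t\<bar> * 3 ^ Suc N)"
      using False by (intro mult_left_mono power_increasing) auto
    finally show ?thesis
      by (simp add: eq mult_ac)
  qed
qed

lemma path_ell_tau: "path ell_tau"
  unfolding path_def continuous_on_eq_continuous_within
proof
  fix t :: real
  assume t01: "t \<in> {0..1}"
  show "continuous (at t within {0..1}) ell_tau"
  proof (cases "t \<in> cantor_set")
    case True
    show ?thesis
      unfolding continuous_within_eps_delta
    proof (intro allI impI)
      fix e :: real
      assume e: "0 < e"
      obtain N where N: "inverse (real (Suc N)) < e / 2"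
        using reals_Archimedean[of "e / 2"] e by auto
      define d where "d = e / (2 * pi * 3 ^ Suc N)"
      have d: "0 < d"
        unfolding d_def using e pi_gt_zero by (intro divide_pos_pos mult_pos_pos) auto
      show "\<exists>d>0. \<forall>s\<in>{0..1}. dist s t < d \<longrightarrow> dist (ell_tau s) (ell_tau t) < e"
      proof (intro exI[of _ d] conjI d ballI impI)
        fix s :: real
        assume s: "s \<in> {0..1}" "dist s t < d"
        have "2 / Suc N < e"
          using N by (simp add: field_simps)
        moreover have "2 * pi * 3 ^ Suc N * \<bar>s - t\<bar> < e"
        proof -
          have "2 * pi * 3 ^ Suc N * \<bar>s - t\<bar> < 2 * pi * 3 ^ Suc N * d"
            using s by (intro mult_strict_left_mono) (auto simp: dist_real_def)
          also have "\<dots> = e"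
            using pi_gt_zero by (simp add: d_def)
          finally show ?thesis .
        qed
        ultimately have "norm (ell_tau s) < e"
          using norm_ell_tau_le[OF True s(1), of N] by linarith
        then show "dist (ell_tau s) (ell_tau t) < e"
          by (simp add: ell_tau_cantor[OF True])
      qed
    qed
  next
    case False
    then have "t \<in> {0..1} - cantor_set"
      using t01 by blast
    then obtain n a where na: "a \<in> gap_left n" "t \<in> third_interval n a"
      unfolding in_third_interval_iff by blast
    have "continuous_on (third_interval n a)
        (\<lambda>t. ell (2 ^ n + gap_rank (third_interval n a) - 1) ((t - a) * 3 ^ Suc n))"
      by (rule continuous_on_compose2[OF ell_continuous[of UNIV]]) (auto intro!: continuous_intros)
    then have "continuous_on (third_interval n a) ell_tau"
      using ell_tau_gap[OF na(1)] by (simp cong: continuous_on_cong)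
    moreover have "open (third_interval n a)"
      by (simp add: third_interval_def)
    ultimately have "isCont ell_tau t"
      using na(2) continuous_on_eq_continuous_at by blast
    then show ?thesis
      by (rule continuous_at_imp_continuous_within)
  qed
qed

lemma earring_circle_iff:
  assumes "1 \<le> n"
  shows "z \<in> earring_circle n \<longleftrightarrow> real n * (norm z)\<^sup>2 = 2 * Re z"
proof -
  have "z \<in> earring_circle n \<longleftrightarrow> (norm (1 / of_nat n - z))\<^sup>2 = (1 / real n)\<^sup>2"
    by (simp add: earring_circle_def dist_norm norm_divide)
  also have "(norm (1 / of_nat n - z))\<^sup>2 = (1 / real n)\<^sup>2 - 2 * Re z / real n + (norm z)\<^sup>2"
    by (simp add: cmod_power2 power2_diff)
  also have "(1 / real n)\<^sup>2 - 2 * Re z / real n + (norm z)\<^sup>2 = (1 / real n)\<^sup>2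
      \<longleftrightarrow> (norm z)\<^sup>2 = 2 * Re z / real n"
    by linarith
  also have "\<dots> \<longleftrightarrow> real n * (norm z)\<^sup>2 = 2 * Re z"
    using assms by (auto simp: field_simps)
  finally show ?thesis .
qed

lemma earring_circle_unique:
  assumes "1 \<le> m" "1 \<le> n" "z \<in> earring_circle m" "z \<in> earring_circle n" "z \<noteq> 0"
  shows "m = n"
proof -
  have "real m * (norm z)\<^sup>2 = real n * (norm z)\<^sup>2"
    using assms(3,4) unfolding earring_circle_iff[OF assms(1)] earring_circle_iff[OF assms(2)] by simp
  then show ?thesis
    using assms(5) by simp
qed

lemma reindex_map_circle:
  assumes "1 \<le> n" "z \<in> earring_circle n"
  shows "reindex_map \<phi> z = of_nat n / of_nat (\<phi> n) * z"
proof (cases "z = 0")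
  case False
  have "(SOME n. 1 \<le> n \<and> z \<in> earring_circle n) = n"
    using assms False earring_circle_unique by (intro some_equality) auto
  then show ?thesis
    by (simp add: reindex_map_def)
qed (simp add: reindex_map_def)

lemma reindex_map_ell:
  assumes "1 \<le> n"
  shows "reindex_map \<phi> (ell n t) = ell (\<phi> n) t"
  using assms unfolding reindex_map_circle[OF assms ell_in_circle] unfolding ell_def by simp

lemma f_odd_ell: "1 \<le> n \<Longrightarrow> f_odd \<circ> ell n = ell (2 * n - 1)"
  and f_even_ell: "1 \<le> n \<Longrightarrow> f_even \<circ> ell n = ell (2 * n)"
  by (auto simp: f_odd_def f_even_def reindex_map_ell)

lemma reindex_map_continuous:
  assumes \<phi>: "\<And>n. 1 \<le> n \<Longrightarrow> n \<le> \<phi> n"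
  shows "continuous_on earring (reindex_map \<phi>)"
  unfolding continuous_on_eq_continuous_within
proof
  fix z
  assume "z \<in> earring"
  then obtain n where n: "1 \<le> n" "z \<in> earring_circle n"
    by (auto simp: earring_def)
  show "continuous (at z within earring) (reindex_map \<phi>)"
  proof (cases "z = 0")
    case True
    have le: "norm (reindex_map \<phi> w) \<le> norm w" if w: "w \<in> earring" for w
    proof -
      obtain m where m: "1 \<le> m" "w \<in> earring_circle m"
        using w unfolding earring_def by auto
      then have "real m / real (\<phi> m) * norm w \<le> 1 * norm w"
        using \<phi>[of m] by (intro mult_right_mono) (auto simp: divide_le_eq)
      then show ?thesis
        by (simp add: reindex_map_circle[OF m] norm_mult norm_divide)
    qed
    have "reindex_map \<phi> 0 = 0"
      by (simp add: reindex_map_def)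
    then show ?thesis
      unfolding continuous_within_eps_delta True
      by (metis dist_0_norm dist_commute le le_less_trans)
  next
    case False
    define g where "g w = 2 * Re w / (norm w)\<^sup>2" for w
    have g: "g w = real m" if "1 \<le> m" "w \<in> earring_circle m" "w \<noteq> 0" for m w
      using that by (simp add: g_def earring_circle_iff field_simps)
    have "(g \<longlongrightarrow> g z) (at z within earring)"
      unfolding g_def using False by (intro tendsto_intros) auto
    then have "\<forall>\<^sub>F w in at z within earring. dist (g w) (g z) < 1"
      by (rule tendstoD) simp
    moreover have "\<forall>\<^sub>F w in at z within earring. w \<noteq> 0"
      using False by (intro tendsto_imp_eventually_ne[OF tendsto_ident_at])
    moreover have "\<forall>\<^sub>F w in at z within earring. w \<in> earring"
      by (simp add: eventually_at_filter)
    ultimately have "\<forall>\<^sub>F w in at z within earring. of_nat n / of_nat (\<phi> n) * w = reindex_map \<phi> w"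
    proof eventually_elim
      case (elim w)
      then obtain m where m: "1 \<le> m" "w \<in> earring_circle m"
        unfolding earring_def by auto
      then have "m = n"
        using g[OF m] g[OF n False] elim by (simp add: dist_real_def)
      then show ?case
        using reindex_map_circle[OF m] by simp
    qed
    moreover have "((\<lambda>w. of_nat n / of_nat (\<phi> n) * w) \<longlongrightarrow> reindex_map \<phi> z) (at z within earring)"
      unfolding reindex_map_circle[OF n] by (intro tendsto_intros)
    ultimately show ?thesis
      unfolding continuous_within by (rule Lim_transform_eventually[rotated])
  qed
qed

lemma reindex_map_in_earring:
  assumes "\<And>n. 1 \<le> n \<Longrightarrow> n \<le> \<phi> n" "z \<in> earring"
  shows "reindex_map \<phi> z \<in> earring"
proof -
  obtain n where n: "1 \<le> n" "z \<in> earring_circle n"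
    using assms(2) unfolding earring_def by auto
  then have \<phi>: "1 \<le> \<phi> n"
    using assms(1)[of n] by simp
  define w where "w = reindex_map \<phi> z"
  have "w = of_real (real n / real (\<phi> n)) * z"
    by (simp add: w_def reindex_map_circle[OF n])
  then have "norm w = real n / real (\<phi> n) * norm z" "Re w = real n / real (\<phi> n) * Re z"
    by (simp_all add: norm_mult norm_divide del: of_real_divide)
  then have "real (\<phi> n) * (norm w)\<^sup>2 = real n / real (\<phi> n) * (real n * (norm z)\<^sup>2)"
    using \<phi> by (simp add: power2_eq_square)
  also have "\<dots> = 2 * Re w"
    using n earring_circle_iff[OF n(1)] \<open>Re w = _\<close> by simp
  finally have "w \<in> earring_circle (\<phi> n)"
    using earring_circle_iff[OF \<phi>] by blast
  then show ?thesis
    using earring_circle_subset[OF \<phi>] by (auto simp: w_def)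
qed

lemma f_odd_map: "based_map earring 0 earring 0 f_odd"
  and f_even_map: "based_map earring 0 earring 0 f_even"
  unfolding based_map_def f_odd_def f_even_def
  by (auto intro!: reindex_map_continuous reindex_map_in_earring)
    (simp_all add: reindex_map_def)

lemma whisker_path:
  "path whisker" "path_image whisker \<subseteq> earring_plus"
  "pathstart whisker = base_plus" "pathfinish whisker = 0"
proof -
  have "whisker t \<in> earring_plus" if "t \<in> {0..1}" for t
    using that unfolding whisker_def earring_plus_def by (intro UnI2 imageI) auto
  then show "path_image whisker \<subseteq> earring_plus"
    by (auto simp: path_image_def)
  show "path whisker" "pathstart whisker = base_plus" "pathfinish whisker = 0"
    unfolding path_def whisker_def base_plus_def pathstart_def pathfinish_def
    by (auto intro!: continuous_intros)
qed

lemma whiskered_loop: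
  assumes "q \<in> loops_at earring 0"
  shows "whisker +++ q +++ reversepath whisker \<in> loops_at earring_plus base_plus"
  using assms whisker_path by (auto simp: loops_at_def path_image_join earring_plus_def)

lemma ell_loop: "1 \<le> n \<Longrightarrow> ell n \<in> loops_at earring 0"
  using ell_in_earring
  by (auto simp: loops_at_def path_def path_image_def pathstart_def pathfinish_def ell_continuous)

lemma ell_tau_loop: "ell_tau \<in> loops_at earring 0"
  using ell_tau_in_earring path_ell_tau ell_tau_cantor cantor_set_ends
  by (auto simp: loops_at_def path_image_def pathstart_def pathfinish_def)

lemma compose_loop:
  assumes "based_map earring 0 earring 0 f" "q \<in> loops_at earring 0"
  shows "f \<circ> q \<in> loops_at earring 0"
  using assms
  by (auto simp: loops_at_def based_map_def pathstart_compose pathfinish_compose path_image_compose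
      intro: path_continuous_image continuous_on_subset)

lemma whiskered_loop_pair:
  assumes "p \<in> loops_at earring 0" "q \<in> loops_at earring 0"
  shows "whisker +++ p +++ reversepath q +++ reversepath whisker \<in> loops_at earring_plus base_plus"
  using assms whisker_path by (auto simp: loops_at_def path_image_join earring_plus_def)

lemma elements_in_carrier:
  shows "1 \<le> n \<Longrightarrow> c_elem n \<in> carrier (fundamental_group earring_plus base_plus)"
    and "1 \<le> n \<Longrightarrow> p_elem n \<in> carrier (fundamental_group earring_plus base_plus)"
    and "c_tau \<in> carrier (fundamental_group earring_plus base_plus)"
    and "p_tau \<in> carrier (fundamental_group earring_plus base_plus)"
  unfolding fundamental_group_def c_elem_def p_elem_def c_tau_def p_tau_def
  by (auto intro!: imageI whiskered_loop whiskered_loop_pair ell_loop ell_tau_loop compose_loop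
      f_odd_map f_even_map)

lemma subgroups:
  shows "subgroup c_subgroup (fundamental_group earring_plus base_plus)"
    and "subgroup p_subgroup (fundamental_group earring_plus base_plus)"
proof -
  have "base_plus \<in> earring_plus"
    by (auto simp: base_plus_def earring_plus_def image_iff intro: bexI[of _ "-1"])
  then interpret group "fundamental_group earring_plus base_plus"
    by (rule group_fundamental_group)
  show "subgroup c_subgroup (fundamental_group earring_plus base_plus)"
    "subgroup p_subgroup (fundamental_group earring_plus base_plus)"
    unfolding c_subgroup_def p_subgroup_def
    by (auto intro!: generate_is_subgroup elements_in_carrier)
qed

end

theory Submission
  imports Defs
begin

text \<open>
  A single covering space separates \<open>p_tau\<close> from the closure.  For any map \<open>h\<close> from a space \<open>X\<close>
  to the base \<open>B\<close> of a covering \<open>p : C \<rightarrow> B\<close>, the classes of the loops in \<open>X\<close> whose image in \<open>B\<close>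
  lifts to a loop at a given point \<open>e\<close> form a subgroup of the fundamental group of \<open>X\<close>.  Such a
  subgroup is always closed with respect to \<open>c_subgroup\<close> and \<open>c_tau\<close>
  (\<open>closed_subgroup_lift_stabilizer\<close>): if the images of all \<open>ell n\<close> lift to loops at \<open>e\<close>, consider
  the lift of the image of \<open>ell_tau\<close> starting at \<open>e\<close>.  It returns to the same point across every
  gap of the Cantor set, and across every interval of a late stage of the Cantor set as well,
  because there the image stays in one evenly covered neighbourhood.  Finitely many such pieces make
  up \<open>[0,1]\<close>, so the lift ends at \<open>e\<close> (\<open>cantor_loop_lift_closed\<close>).

  It remains to find a covering whose subgroup contains every \<open>p_elem n\<close> but not \<open>p_tau\<close>.  The map
  \<open>detector\<close> sends the first circle to a loop \<open>x\<close> around 1 in the plane without 0 and 1, the third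
  and the fourth circle to a loop \<open>z\<close> around 0, and everything else to the base point.  The class
  \<open>p_elem 1\<close> is then sent to \<open>x\<close>, and all other \<open>p_elem n\<close> to 1.  But \<open>ell_tau\<close> runs through its
  second loop before its first one, so that \<open>p_tau\<close> is sent to \<open>z x z\<inverse>\<close>.  A covering in which the
  lift of \<open>x\<close> at \<open>e\<close> is closed and that of \<open>z x z\<inverse>\<close> is not therefore finishes the proof.  It must
  not be a regular covering, and \<open>w \<mapsto> (w\<^sup>2 - 1)\<^sup>2\<close> with four sheets is one: on the intermediate
  \<open>u\<close>-plane, where \<open>u = w\<^sup>2 - 1\<close>, the loop \<open>z\<close> exchanges the two square roots \<open>u\<close> of the base point,
  and \<open>x\<close> lifts to a loop around 1 at one of them and around \<open>-1\<close> at the other.  Only the latter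
  winds around the branch point of \<open>w = \<surd>(1 + u)\<close>.
\<close>

section \<open>Lifts of paths and stabilizers in covering spaces\<close>

definition is_lift ::
    "'a::real_normed_vector set \<Rightarrow> ('a \<Rightarrow> 'b::real_normed_vector) \<Rightarrow> (real \<Rightarrow> 'b) \<Rightarrow> (real \<Rightarrow> 'a) \<Rightarrow> bool" where
  "is_lift C p g q \<longleftrightarrow> path q \<and> path_image q \<subseteq> C \<and> (\<forall>t\<in>{0..1}. p (q t) = g t)"

lemma is_lift_join:
  assumes "is_lift C p g q" "is_lift C p g' q'" "pathfinish q = pathstart q'"
  shows "is_lift C p (g +++ g') (q +++ q')"
proof -
  have "path (q +++ q')" "path_image (q +++ q') \<subseteq> C"
    using assms by (auto simp: is_lift_def path_image_join)
  moreover have "p ((q +++ q') t) = (g +++ g') t" if "t \<in> {0..1}" for t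
    using assms that by (auto simp: is_lift_def joinpaths_def)
  ultimately show ?thesis
    by (simp add: is_lift_def)
qed

lemma is_lift_reversepath:
  assumes "is_lift C p g q"
  shows "is_lift C p (reversepath g) (reversepath q)"
proof -
  have "path (reversepath q)" "path_image (reversepath q) \<subseteq> C"
    using assms by (auto simp: is_lift_def)
  moreover have "p (reversepath q t) = reversepath g t" if "t \<in> {0..1}" for t
    using assms that by (auto simp: is_lift_def reversepath_def)
  ultimately show ?thesis
    by (simp add: is_lift_def)
qed

lemma is_lift_const: "e \<in> C \<Longrightarrow> is_lift C p (\<lambda>_. p e) (\<lambda>_. e)"
  by (auto simp: is_lift_def path_def path_image_def)

lemma is_lift_exists:
  assumes "covering_space C p B" "path g" "path_image g \<subseteq> B" "e \<in> C" "p e = pathstart g"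
  obtains q where "is_lift C p g q" "pathstart q = e"
  using covering_space_lift_path_strong[OF assms(1,4,2,3)] assms(5) by (metis is_lift_def)

lemma is_lift_path:
  assumes "covering_space C p B" "is_lift C p g q"
  shows "path g" "path_image g \<subseteq> B"
proof -
  have q: "continuous_on {0..1} q" "q ` {0..1} \<subseteq> C" and pq: "\<And>t. t \<in> {0..1} \<Longrightarrow> p (q t) = g t"
    using assms(2) by (auto simp: is_lift_def path_def path_image_def)
  have "continuous_on {0..1} (p \<circ> q)"
    using q covering_space_imp_continuous[OF assms(1)]
    by (intro continuous_on_compose) (auto intro: continuous_on_subset)
  then show "path g"
    unfolding path_def by (rule continuous_on_eq) (simp add: pq)
  show "path_image g \<subseteq> B"
  proof -
    have "g t \<in> B" if "t \<in> {0..1}" for t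
    proof -
      have "q t \<in> C"
        using q(2) that by (rule subsetD[OF _ imageI])
      then have "p (q t) \<in> B"
        using covering_space_imp_surjective[OF assms(1)] by blast
      then show ?thesis
        using pq[OF that] by simp
    qed
    then show ?thesis
      by (auto simp: path_image_def)
  qed
qed

lemma is_lift_finish_unique:
  assumes "covering_space C p B" "homotopic_paths B g g'"
    and "is_lift C p g q" "is_lift C p g' q'" "pathstart q = pathstart q'"
  shows "pathfinish q = pathfinish q'"
  using is_lift_path[OF assms(1,3)] is_lift_path[OF assms(1,4)] assms covering_space_monodromy[of C p B g g' q q']
  by (auto simp: is_lift_def)

lemma is_lift_finish_unique_same:
  assumes "covering_space C p B"
    and "is_lift C p g q" "is_lift C p g q'" "pathstart q = pathstart q'"
  shows "pathfinish q = pathfinish q'"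
  using is_lift_finish_unique[OF assms(1) _ assms(2-4)] is_lift_path[OF assms(1,2)] by simp

text \<open>This is the stabilizer of \<open>e\<close> under the monodromy action, pulled back along \<open>h\<close>.\<close>

definition lift_stabilizer ::
    "'a::real_normed_vector set \<Rightarrow> ('a \<Rightarrow> 'b::real_normed_vector) \<Rightarrow> 'a \<Rightarrow> ('c::real_normed_vector \<Rightarrow> 'b) \<Rightarrow>
     'c set \<Rightarrow> 'c \<Rightarrow> (real \<Rightarrow> 'c) set set" where
  "lift_stabilizer C p e h X x0 =
     path_class X ` {\<gamma> \<in> loops_at X x0. \<exists>q. is_lift C p (h \<circ> \<gamma>) q \<and> pathstart q = e \<and> pathfinish q = e}"

text \<open>By homotopy lifting, the end point of a lift depends only on the class of the loop, so any
  representative and any one lift decide membership.\<close>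

lemma class_in_lift_stabilizer_iff:
  assumes cov: "covering_space C p B" and h: "continuous_on X h" "h ` X \<subseteq> B"
    and \<gamma>: "\<gamma> \<in> loops_at X x0" and q: "is_lift C p (h \<circ> \<gamma>) q" "pathstart q = e"
  shows "path_class X \<gamma> \<in> lift_stabilizer C p e h X x0 \<longleftrightarrow> pathfinish q = e"
proof
  assume "path_class X \<gamma> \<in> lift_stabilizer C p e h X x0"
  then obtain \<delta> r where \<delta>: "\<delta> \<in> loops_at X x0" "path_class X \<gamma> = path_class X \<delta>"
    and r: "is_lift C p (h \<circ> \<delta>) r" "pathstart r = e" "pathfinish r = e"
    unfolding lift_stabilizer_def by blast
  have "homotopic_paths X \<gamma> \<delta>"
    using \<delta> \<gamma> loops_at_class_eq_iff by blast
  then have "homotopic_paths B (h \<circ> \<gamma>) (h \<circ> \<delta>)"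
    using h by (intro homotopic_paths_continuous_image[where S = X]) auto
  then show "pathfinish q = e"
    using is_lift_finish_unique[OF cov _ q(1) r(1)] q r by simp
next
  assume "pathfinish q = e"
  then show "path_class X \<gamma> \<in> lift_stabilizer C p e h X x0"
    using \<gamma> q unfolding lift_stabilizer_def by blast
qed

lemma inv_path_class:
  fixes X :: "'a::real_normed_vector set"
  assumes "x0 \<in> X" "\<gamma> \<in> loops_at X x0"
  shows "inv\<^bsub>fundamental_group X x0\<^esub> path_class X \<gamma> = path_class X (reversepath \<gamma>)"
proof -
  interpret group "fundamental_group X x0"
    by (rule group_fundamental_group[OF assms(1)])
  have rev: "reversepath \<gamma> \<in> loops_at X x0"
    using assms(2) by (auto simp: loops_at_def)
  have "homotopic_paths X (reversepath \<gamma> +++ \<gamma>) (linepath x0 x0)"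
    using homotopic_paths_linv[of \<gamma> X] assms(2) by (auto simp: loops_at_def)
  moreover have "linepath x0 x0 = (\<lambda>_. x0)"
    by (auto simp: linepath_def algebra_simps)
  ultimately have "path_class X (reversepath \<gamma>) \<otimes>\<^bsub>fundamental_group X x0\<^esub> path_class X \<gamma>
      = \<one>\<^bsub>fundamental_group X x0\<^esub>"
    using assms(2) rev loops_at_join[OF rev assms(2)] loops_at_class_eq_iff
    by (simp add: mult_path_class) (force simp: fundamental_group_def)
  then show ?thesis
    using assms(2) rev by (intro inv_equality) (auto simp: fundamental_group_def)
qed

lemma subgroup_lift_stabilizer:
  assumes cov: "covering_space C p B" and h: "continuous_on X h" "h ` X \<subseteq> B"
    and "x0 \<in> X" "e \<in> C" "p e = h x0"
  shows "subgroup (lift_stabilizer C p e h X x0) (fundamental_group X x0)"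
proof -
  let ?K = "lift_stabilizer C p e h X x0"
  interpret group "fundamental_group X x0"
    by (rule group_fundamental_group[OF assms(4)])
  show ?thesis
  proof (rule subgroupI)
    show "?K \<subseteq> carrier (fundamental_group X x0)"
      by (auto simp: lift_stabilizer_def fundamental_group_def)
    have "(\<lambda>_. x0) \<in> loops_at X x0"
      using assms(4) by (auto simp: loops_at_def path_def path_image_def pathstart_def pathfinish_def)
    moreover have "is_lift C p (h \<circ> (\<lambda>_. x0)) (\<lambda>_. e)"
      using is_lift_const[OF assms(5), of p] assms(6) by (simp add: comp_def)
    ultimately show "?K \<noteq> {}"
      unfolding lift_stabilizer_def by (force simp: pathstart_def pathfinish_def)
    show "inv\<^bsub>fundamental_group X x0\<^esub> A \<in> ?K" if "A \<in> ?K" for A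
    proof -
      from that obtain \<gamma> q where \<gamma>: "\<gamma> \<in> loops_at X x0" "A = path_class X \<gamma>"
        and q: "is_lift C p (h \<circ> \<gamma>) q" "pathstart q = e" "pathfinish q = e"
        unfolding lift_stabilizer_def by blast
      have "is_lift C p (h \<circ> reversepath \<gamma>) (reversepath q)"
        using is_lift_reversepath[OF q(1)] by (simp add: reversepath_def comp_def)
      moreover have "reversepath \<gamma> \<in> loops_at X x0"
        using \<gamma> by (auto simp: loops_at_def)
      ultimately show ?thesis
        using q \<gamma> unfolding lift_stabilizer_def
        by (auto simp: inv_path_class[OF assms(4)] intro!: imageI exI[of _ "reversepath q"])
    qed
    show "A \<otimes>\<^bsub>fundamental_group X x0\<^esub> B \<in> ?K" if "A \<in> ?K" "B \<in> ?K" for A B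
    proof -
      from that(1) obtain \<gamma> q where \<gamma>: "\<gamma> \<in> loops_at X x0" "A = path_class X \<gamma>"
        and q: "is_lift C p (h \<circ> \<gamma>) q" "pathstart q = e" "pathfinish q = e"
        unfolding lift_stabilizer_def by blast
      from that(2) obtain \<delta> r where \<delta>: "\<delta> \<in> loops_at X x0" "B = path_class X \<delta>"
        and r: "is_lift C p (h \<circ> \<delta>) r" "pathstart r = e" "pathfinish r = e"
        unfolding lift_stabilizer_def by blast
      have "is_lift C p (h \<circ> (\<gamma> +++ \<delta>)) (q +++ r)"
        using is_lift_join[OF q(1) r(1)] q r by (simp add: path_compose_join)
      then show ?thesis
        using \<gamma> \<delta> q r loops_at_join[OF \<gamma>(1) \<delta>(1)] unfolding lift_stabilizer_def
        by (auto simp: mult_path_class intro!: imageI exI[of _ "q +++ r"])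
    qed
  qed
qed


section \<open>Lifting along the Cantor set\<close>

text \<open>Left end points of the intervals of length \<open>1 / 3 ^ n\<close> that make up \<open>cantor_stage n\<close>.\<close>

primrec stage_left :: "nat \<Rightarrow> real set" where
  "stage_left 0 = {0}"
| "stage_left (Suc n) = (\<lambda>x. x / 3) ` stage_left n \<union> (\<lambda>x. 2 / 3 + x / 3) ` stage_left n"

lemma stage_left_bounds: "a \<in> stage_left n \<Longrightarrow> 0 \<le> a \<and> a + 1 / 3 ^ n \<le> 1"
proof (induction n arbitrary: a)
  case (Suc n)
  then obtain b where "b \<in> stage_left n" "a = b / 3 \<or> a = 2 / 3 + b / 3"
    by auto
  moreover have "1 / 3 ^ Suc n = (1 / 3 ^ n) / (3::real)"
    by simp
  ultimately show ?case
    using Suc.IH[of b] by (auto simp del: power_Suc)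
qed auto

lemma stage_interval_ends_in_cantor_set:
  assumes "a \<in> stage_left n" "c \<in> {0, 1}"
  shows "a + c / 3 ^ n \<in> cantor_set"
  using assms(1)
proof (induction n arbitrary: a)
  case 0
  then show ?case
    using assms(2) cantor_set_ends by auto
next
  case (Suc n)
  then obtain b where b: "b \<in> stage_left n" "a = b / 3 \<or> a = 2 / 3 + b / 3"
    by auto
  have "0 \<le> c / 3 ^ n" "c / 3 ^ n \<le> 1 / 3 ^ n"
    using assms(2) by auto
  then have "b + c / 3 ^ n \<in> {0..1}"
    using stage_left_bounds[OF b(1)] unfolding atLeastAtMost_iff by linarith
  moreover have "b / 3 + c / 3 ^ Suc n = (b + c / 3 ^ n) / 3"
    "2 / 3 + b / 3 + c / 3 ^ Suc n = 2 / 3 + (b + c / 3 ^ n) / 3"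
    by (simp_all add: add_divide_distrib)
  ultimately show ?case
    using Suc.IH[OF b(1)] b(2) cantor_set_left cantor_set_right by metis
qed

text \<open>An interval of one stage consists of an interval of the next stage, a gap, and another interval
  of the next stage.\<close>

lemma stage_left_split:
  assumes "a \<in> stage_left n"
  shows "a \<in> stage_left (Suc n)" "a + 1 / 3 ^ Suc n \<in> gap_left n" "a + 2 / 3 ^ Suc n \<in> stage_left (Suc n)"
proof -
  have "a \<in> stage_left (Suc n) \<and> a + 1 / 3 ^ Suc n \<in> gap_left n \<and> a + 2 / 3 ^ Suc n \<in> stage_left (Suc n)"
    using assms
  proof (induction n arbitrary: a)
    case 0
    then show ?case by auto
  next
    case (Suc n)
    then obtain b where b: "b \<in> stage_left n" and a: "a = b / 3 \<or> a = 2 / 3 + b / 3"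
      by auto
    have "b / 3 + c / 3 ^ Suc (Suc n) = (b + c / 3 ^ Suc n) / 3"
      "2 / 3 + b / 3 + c / 3 ^ Suc (Suc n) = 2 / 3 + (b + c / 3 ^ Suc n) / 3" for c :: real
      by (simp_all add: add_divide_distrib)
    note eq = this
    have "stage_left (Suc (Suc n)) = (\<lambda>x. x / 3) ` stage_left (Suc n) \<union> (\<lambda>x. 2 / 3 + x / 3) ` stage_left (Suc n)"
      "gap_left (Suc n) = (\<lambda>x. x / 3) ` gap_left n \<union> (\<lambda>x. 2 / 3 + x / 3) ` gap_left n"
      by (rule stage_left.simps gap_left.simps)+
    moreover have "x \<in> S \<Longrightarrow> x / 3 \<in> (\<lambda>x. x / 3) ` S" "x \<in> S \<Longrightarrow> 2 / 3 + x / 3 \<in> (\<lambda>x. 2 / 3 + x / 3) ` S"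
      for x :: real and S
      by auto
    ultimately show ?case
      using Suc.IH[OF b] a eq[of 1] eq[of 2] by (elim disjE) (simp_all only: Un_iff simp_thms)
  qed
  then show "a \<in> stage_left (Suc n)" "a + 1 / 3 ^ Suc n \<in> gap_left n" "a + 2 / 3 ^ Suc n \<in> stage_left (Suc n)"
    by auto
qed

lemma is_lift_subinterval:
  assumes "is_lift C p g q" "0 \<le> a" "0 \<le> d" "a + d \<le> 1"
  shows "is_lift C p (\<lambda>t. g (a + d * t)) (\<lambda>t. q (a + d * t))"
proof -
  have in01: "a + d * t \<in> {0..1}" if "t \<in> {0..1}" for t
    using assms that mult_left_le[of t d] mult_nonneg_nonneg[of d t] by (auto simp del: mult_nonneg_nonneg)
  have "continuous_on {0..1} (\<lambda>t. q (a + d * t))"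
    by (rule continuous_on_compose2[of "{0..1}" q])
      (use assms(1) in01 in \<open>auto simp: is_lift_def path_def intro!: continuous_intros\<close>)
  then show ?thesis
    using assms(1) in01 unfolding is_lift_def path_def path_image_def by auto
qed

text \<open>Inside an evenly covered neighbourhood the inverse of \<open>p\<close> on the sheet of \<open>e\<close> lifts loops to
  loops.\<close>

lemma is_lift_small_loop:
  assumes cov: "covering_space C p B" and "e \<in> C"
  obtains \<epsilon> where "0 < \<epsilon>"
    "\<And>g. \<lbrakk>path g; path_image g \<subseteq> B \<inter> ball (p e) \<epsilon>; pathstart g = p e; pathfinish g = p e\<rbrakk>
       \<Longrightarrow> \<exists>q. is_lift C p g q \<and> pathstart q = e \<and> pathfinish q = e"
proof -
  obtain u T s where u: "e \<in> u" "u \<subseteq> C" and T: "openin (top_of_set B) T" and s: "homeomorphism u T p s"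
    using covering_space_local_homeomorphism[OF assms]
    by (metis openin_imp_subset)
  have "p e \<in> T"
    using s u(1) by (auto simp: homeomorphism_def)
  then obtain \<epsilon> where \<epsilon>: "0 < \<epsilon>" "ball (p e) \<epsilon> \<inter> B \<subseteq> T"
    using T unfolding openin_contains_ball by blast
  show thesis
  proof (rule that[OF \<epsilon>(1)])
    fix g
    assume g: "path g" "path_image g \<subseteq> B \<inter> ball (p e) \<epsilon>" "pathstart g = p e" "pathfinish g = p e"
    have gT: "path_image g \<subseteq> T"
      using g(2) \<epsilon>(2) by blast
    have "path (s \<circ> g)"
      using g(1) gT s by (intro path_continuous_image) (auto simp: homeomorphism_def intro: continuous_on_subset)
    moreover have "s ` T \<subseteq> C"
      using u(2) s by (simp add: homeomorphism_def)
    then have "path_image (s \<circ> g) \<subseteq> C"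
      using gT by (auto simp: path_image_compose)
    moreover have "p ((s \<circ> g) t) = g t" if "t \<in> {0..1}" for t
    proof -
      have "g t \<in> T"
        using gT that by (auto simp: path_image_def)
      then show ?thesis
        using homeomorphism_apply2[OF s] by simp
    qed
    moreover have "s (p e) = e"
      using s u(1) by (auto simp: homeomorphism_def)
    ultimately show "\<exists>q. is_lift C p g q \<and> pathstart q = e \<and> pathfinish q = e"
      using g(3,4) by (intro exI[of _ "s \<circ> g"]) (auto simp: is_lift_def pathstart_compose pathfinish_compose)
  qed
qed

text \<open>The lift \<open>q\<close> returns to its starting point across each interval of a stage of the Cantor set.  At a
  late stage this holds because \<open>g\<close> is uniformly continuous and so stays close to its value on the
  Cantor set.  An interval of an earlier stage is two intervals of the next stage with a gap in
  between, where the assumption on gaps applies.  Stage 0 is the claim.\<close>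

lemma cantor_loop_lift_closed:
  assumes cov: "covering_space C p B" and lift: "is_lift C p g q"
    and const: "\<And>t. t \<in> cantor_set \<Longrightarrow> g t = p (pathstart q)"
    and gap: "\<And>n a. a \<in> gap_left n \<Longrightarrow> \<exists>r. is_lift C p (\<lambda>t. g (a + 1 / 3 ^ Suc n * t)) r
        \<and> pathstart r = pathstart q \<and> pathfinish r = pathstart q"
  shows "pathfinish q = pathstart q"
proof -
  define e where "e = pathstart q"
  have "e \<in> C"
    using lift by (auto simp: e_def is_lift_def)
  \<comment> \<open>A lift of the whole path restricts to a lift of each subpath, so it agrees there with the closed one.\<close>
  have subpath_closed: "q (a + d) = e"
    if "q a = e" "0 \<le> a" "0 \<le> d" "a + d \<le> 1"
      and ex: "\<exists>r. is_lift C p (\<lambda>t. g (a + d * t)) r \<and> pathstart r = e \<and> pathfinish r = e" for a d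
  proof -
    obtain r where r: "is_lift C p (\<lambda>t. g (a + d * t)) r" "pathstart r = e" "pathfinish r = e"
      using ex by blast
    have "pathfinish (\<lambda>t. q (a + d * t)) = pathfinish r"
      using that r by (intro is_lift_finish_unique_same[OF cov is_lift_subinterval[OF lift] r(1)])
        (auto simp: pathstart_def)
    then show ?thesis
      using r by (simp add: pathfinish_def)
  qed
  obtain \<epsilon> where \<epsilon>: "0 < \<epsilon>"
    "\<And>g. \<lbrakk>path g; path_image g \<subseteq> B \<inter> ball (p e) \<epsilon>; pathstart g = p e; pathfinish g = p e\<rbrakk>
       \<Longrightarrow> \<exists>q. is_lift C p g q \<and> pathstart q = e \<and> pathfinish q = e"
    using is_lift_small_loop[OF cov \<open>e \<in> C\<close>] by blast
  have g: "continuous_on {0..1} g" "g ` {0..1} \<subseteq> B"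
    using is_lift_path[OF cov lift] by (auto simp: path_def path_image_def)
  have "uniformly_continuous_on {0..1} g"
    using g(1) by (rule compact_uniformly_continuous) simp
  then obtain \<delta> where \<delta>: "0 < \<delta>" "\<And>x y. \<lbrakk>x \<in> {0..1}; y \<in> {0..1}; dist y x < \<delta>\<rbrakk> \<Longrightarrow> dist (g y) (g x) < \<epsilon>"
    unfolding uniformly_continuous_on_def using \<epsilon>(1) by metis
  obtain N where N: "(1 / 3 :: real) ^ N < \<delta>"
    using real_arch_pow_inv[OF \<delta>(1), of "1 / 3"] by auto
  have "q (a + 1 / 3 ^ n) = e" if "a \<in> stage_left n" "q a = e" "n \<le> N" for a n
    using that(3,1,2)
  proof (induction n arbitrary: a rule: inc_induct)
    case base
    note a = stage_left_bounds[OF base(1)] 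
    have ends: "a \<in> cantor_set" "a + 1 / 3 ^ N \<in> cantor_set"
      using stage_interval_ends_in_cantor_set[OF base(1), of 0] stage_interval_ends_in_cantor_set[OF base(1), of 1]
      by simp_all
    have in01: "a + 1 / 3 ^ N * t \<in> {0..1}" if "t \<in> {0..1}" for t
      using a that mult_left_le[of t "1 / 3 ^ N"] by auto
    have "path (\<lambda>t. g (a + 1 / 3 ^ N * t))"
      unfolding path_def by (rule continuous_on_compose2[OF g(1)]) (use in01 in \<open>auto intro!: continuous_intros\<close>)
    moreover have "g (a + 1 / 3 ^ N * t) \<in> B \<inter> ball (p e) \<epsilon>" if t: "t \<in> {0..1}" for t
    proof
      show "g (a + 1 / 3 ^ N * t) \<in> B"
        using g(2) in01[OF t] by blast
      have "dist (a + 1 / 3 ^ N * t) a \<le> (1 / 3) ^ N"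
        using t mult_left_le[of t "1 / 3 ^ N"] by (simp add: dist_real_def power_one_over divide_right_mono)
      then have "dist (g (a + 1 / 3 ^ N * t)) (g a) < \<epsilon>"
        using N in01[OF t] a in01[of 0] by (intro \<delta>(2)) auto
      then show "g (a + 1 / 3 ^ N * t) \<in> ball (p e) \<epsilon>"
        using const[OF ends(1)] by (simp add: e_def dist_commute)
    qed
    ultimately show ?case
      using a base const[OF ends(1)] const[OF ends(2)]
      by (intro subpath_closed \<epsilon>(2)) (auto simp: path_image_def pathstart_def pathfinish_def e_def)
  next
    case (step n)
    note split = stage_left_split[OF step.prems(1)]
    have "q (a + 1 / 3 ^ Suc n) = e"
      using step.IH[OF split(1) step.prems(2)] .
    then have "q (a + 1 / 3 ^ Suc n + 1 / 3 ^ Suc n) = e"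
      using gap[OF split(2)] gap_left_in_01[OF split(2)]
      by (intro subpath_closed[of "a + 1 / 3 ^ Suc n" "1 / 3 ^ Suc n"]) (auto simp: e_def simp del: power_Suc)
    then have "q (a + 2 / 3 ^ Suc n) = e"
      by (simp add: add.assoc)
    then have "q (a + 2 / 3 ^ Suc n + 1 / 3 ^ Suc n) = e"
      using step.IH[OF split(3)] by blast
    then show ?case
      by (simp add: add.assoc flip: add_divide_distrib)
  qed
  from this[of 0 0] show ?thesis
    by (simp add: e_def pathstart_def pathfinish_def)
qed

text \<open>Given a test map \<open>f\<close>, lift \<open>h \<circ> f\<close> along the whisker.  The loops \<open>h \<circ> f \<circ> ell n\<close> then all lift
  to loops at the end point of that lift, and \<open>cantor_loop_lift_closed\<close> gives the same for
  \<open>h \<circ> f \<circ> ell_tau\<close>.\<close>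

lemma closed_subgroup_lift_stabilizer:
  assumes cov: "covering_space C p B" and h: "continuous_on X h" "h ` X \<subseteq> B"
    and x0: "x0 \<in> X" and e: "e \<in> C" "p e = h x0"
  shows "closed_subgroup earring_plus base_plus c_subgroup c_tau X x0 (lift_stabilizer C p e h X x0)"
  unfolding closed_subgroup_def
proof (intro conjI allI impI)
  let ?K = "lift_stabilizer C p e h X x0"
  show "subgroup ?K (fundamental_group X x0)"
    using assms by (rule subgroup_lift_stabilizer)
  fix f
  assume "based_map earring_plus base_plus X x0 f \<and> induced_hom X f ` c_subgroup \<subseteq> ?K"
  then have f: "based_map earring_plus base_plus X x0 f" and sub: "induced_hom X f ` c_subgroup \<subseteq> ?K"
    by auto
  define k where "k = h \<circ> f"
  have k: "continuous_on earring_plus k" "k ` earring_plus \<subseteq> B" "k base_plus = h x0"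
  proof -
    show "continuous_on earring_plus k"
      unfolding k_def using f h
      by (intro continuous_on_compose) (auto simp: based_map_def intro: continuous_on_subset)
  qed (use f h in \<open>auto simp: based_map_def k_def\<close>)
  have k_path: "path (k \<circ> \<gamma>)" "path_image (k \<circ> \<gamma>) \<subseteq> B" if "path \<gamma>" "path_image \<gamma> \<subseteq> earring_plus" for \<gamma>
    using path_continuous_image[OF that(1) continuous_on_subset[OF k(1) that(2)]] that(2) k(2)
    by (auto simp: path_image_compose)
  obtain \<omega> where \<omega>: "is_lift C p (k \<circ> whisker) \<omega>" "pathstart \<omega> = e"
    using is_lift_exists[OF cov k_path[OF whisker_path(1,2)] e(1)] k(3) whisker_path e
    by (metis pathstart_compose)
  define e' where "e' = pathfinish \<omega>"
  have e': "e' \<in> C" "p e' = k 0"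
    using \<omega> whisker_path(4) by (auto simp: is_lift_def e'_def pathfinish_def path_image_def)
  have earring_sub: "earring \<subseteq> earring_plus"
    by (auto simp: earring_plus_def)
  \<comment> \<open>Conjugation by the whisker moves the base point of the lifts from \<open>e\<close> to \<open>e'\<close>.\<close>
  have conj: "path_class X (f \<circ> (whisker +++ \<gamma> +++ reversepath whisker)) \<in> ?K \<longleftrightarrow> pathfinish q = e'"
    if \<gamma>: "\<gamma> \<in> loops_at earring 0" and q: "is_lift C p (k \<circ> \<gamma>) q" "pathstart q = e'" for \<gamma> q
  proof -
    let ?\<gamma> = "whisker +++ \<gamma> +++ reversepath whisker"
    have "?\<gamma> \<in> loops_at earring_plus base_plus"
      using \<gamma> by (rule whiskered_loop)
    then have loop: "f \<circ> ?\<gamma> \<in> loops_at X x0"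
      using f by (auto simp: loops_at_def based_map_def path_image_compose pathstart_compose pathfinish_compose
          intro!: path_continuous_image intro: continuous_on_subset)
    have comp: "h \<circ> (f \<circ> ?\<gamma>) = (k \<circ> whisker) +++ (k \<circ> \<gamma>) +++ (k \<circ> reversepath whisker)"
      by (simp add: k_def path_compose_join comp_assoc)
    have "p (pathfinish q) = k 0"
      using q(1) \<gamma> by (auto simp: is_lift_def loops_at_def pathfinish_def)
    moreover have "pathfinish q \<in> C"
      using q(1) by (auto simp: is_lift_def)
    moreover have rev: "path (k \<circ> reversepath whisker)" "path_image (k \<circ> reversepath whisker) \<subseteq> B"
      using k_path[of "reversepath whisker"] whisker_path by auto
    ultimately obtain r where r: "is_lift C p (k \<circ> reversepath whisker) r" "pathstart r = pathfinish q"
      using is_lift_exists[OF cov rev, of "pathfinish q"] whisker_path(4)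
      by (metis pathstart_compose pathstart_reversepath)
    have lift: "is_lift C p (h \<circ> (f \<circ> ?\<gamma>)) (\<omega> +++ q +++ r)"
      unfolding comp using \<omega> q r by (intro is_lift_join) (auto simp: e'_def)
    have "path_class X (f \<circ> ?\<gamma>) \<in> ?K \<longleftrightarrow> pathfinish r = e"
      using class_in_lift_stabilizer_iff[OF cov h loop lift] \<omega>(2) by simp
    also have "\<dots> \<longleftrightarrow> pathfinish q = e'"
    proof
      have rev_\<omega>: "is_lift C p (k \<circ> reversepath whisker) (reversepath \<omega>)"
        using is_lift_reversepath[OF \<omega>(1)] by (simp add: reversepath_def comp_def)
      show "pathfinish r = e" if "pathfinish q = e'"
        using is_lift_finish_unique_same[OF cov r(1) rev_\<omega>] r(2) \<omega>(2) that by (simp add: e'_def)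
      have "is_lift C p (k \<circ> whisker) (reversepath r)"
        using is_lift_reversepath[OF r(1)] by (simp add: reversepath_def comp_def)
      from is_lift_finish_unique_same[OF cov this \<omega>(1)]
      show "pathfinish q = e'" if "pathfinish r = e"
        using r(2) \<omega>(2) that by (simp add: e'_def)
    qed
    finally show ?thesis .
  qed
  have lift_from_e': "\<exists>q. is_lift C p (k \<circ> \<gamma>) q \<and> pathstart q = e'" if "\<gamma> \<in> loops_at earring 0" for \<gamma>
  proof -
    have "path \<gamma>" "path_image \<gamma> \<subseteq> earring_plus" "pathstart \<gamma> = 0"
      using that earring_sub by (auto simp: loops_at_def)
    then show ?thesis
      using is_lift_exists[OF cov k_path e'(1), of \<gamma>] e'(2) by (metis pathstart_compose)
  qed
  have ell_lift: "\<exists>q. is_lift C p (k \<circ> ell n) q \<and> pathstart q = e' \<and> pathfinish q = e'" if n: "1 \<le> n" for n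
  proof -
    obtain q where q: "is_lift C p (k \<circ> ell n) q" "pathstart q = e'"
      using lift_from_e'[OF ell_loop[OF n]] by blast
    have "c_elem n \<in> c_subgroup"
      unfolding c_subgroup_def using n by (intro generate.incl) auto
    then have "path_class X (f \<circ> (whisker +++ ell n +++ reversepath whisker)) \<in> ?K"
      using sub induced_hom_class[OF f whiskered_loop[OF ell_loop[OF n]]] unfolding c_elem_def by blast
    then show ?thesis
      using conj[OF ell_loop[OF n] q] q by blast
  qed
  obtain q where q: "is_lift C p (k \<circ> ell_tau) q" "pathstart q = e'"
    using lift_from_e'[OF ell_tau_loop] by blast
  have "pathfinish q = pathstart q"
  proof (rule cantor_loop_lift_closed[OF cov q(1)])
    show "(k \<circ> ell_tau) t = p (pathstart q)" if "t \<in> cantor_set" for t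
      using that e'(2) q(2) by (simp add: ell_tau_cantor)
    fix n a
    assume a: "a \<in> gap_left n"
    define m where "m = 2 ^ n + gap_rank (third_interval n a) - 1"
    have "1 \<le> m"
      using gap_index_bounds[OF a] by (simp add: m_def)
    then obtain r where r: "is_lift C p (k \<circ> ell m) r" "pathstart r = e'" "pathfinish r = e'"
      using ell_lift by blast
    have "(k \<circ> ell_tau) (a + 1 / 3 ^ Suc n * t) = (k \<circ> ell m) t" if "t \<in> {0..1}" for t
    proof -
      have "a + 1 / 3 ^ Suc n * t \<in> {a..a + 1 / 3 ^ Suc n}"
        using that mult_left_le[of t "1 / 3 ^ Suc n"] by (auto simp del: power_Suc)
      then have "ell_tau (a + 1 / 3 ^ Suc n * t) = ell m (1 / 3 ^ Suc n * t * 3 ^ Suc n)"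
        using ell_tau_closed_gap[OF a] by (simp add: m_def del: power_Suc)
      then show ?thesis
        by simp
    qed
    then have "is_lift C p (\<lambda>t. (k \<circ> ell_tau) (a + 1 / 3 ^ Suc n * t)) r"
      using r(1) by (auto simp: is_lift_def simp del: power_Suc)
    then show "\<exists>r. is_lift C p (\<lambda>t. (k \<circ> ell_tau) (a + 1 / 3 ^ Suc n * t)) r
        \<and> pathstart r = pathstart q \<and> pathfinish r = pathstart q"
      using r q(2) by auto
  qed
  then have "path_class X (f \<circ> (whisker +++ ell_tau +++ reversepath whisker)) \<in> ?K"
    using conj[OF ell_tau_loop q] q(2) by simp
  then show "induced_hom X f c_tau \<in> ?K"
    using induced_hom_class[OF f whiskered_loop[OF ell_tau_loop]] by (simp add: c_tau_def)
qed

section \<open>A non-normal four-sheeted covering of the twice punctured plane\<close>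

text \<open>A continuous section has closed image in the preimage of its domain.  When finitely many disjoint
  sections fill that preimage, their images are therefore open too and are the sheets.\<close>

lemma covering_space_finite_sections:
  fixes p :: "'a::real_normed_vector \<Rightarrow> 'b::real_normed_vector"
  assumes p: "continuous_on C p" "p ` C = B"
    and sections: "\<And>x. x \<in> B \<Longrightarrow> \<exists>T R. x \<in> T \<and> openin (top_of_set B) T \<and> finite R \<and>
      (\<forall>r\<in>R. continuous_on T r \<and> r ` T \<subseteq> C \<and> (\<forall>y\<in>T. p (r y) = y)) \<and>
      (\<forall>w\<in>C. p w \<in> T \<longrightarrow> (\<exists>r\<in>R. r (p w) = w)) \<and>
      pairwise (\<lambda>r r'. \<forall>y\<in>T. r y \<noteq> r' y) R"
  shows "covering_space C p B"
proof (rule covering_spaceI[OF p])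
  fix x
  assume "x \<in> B"
  then obtain T R where T: "x \<in> T" "openin (top_of_set B) T" and "finite R"
    and R: "\<forall>r\<in>R. continuous_on T r \<and> r ` T \<subseteq> C \<and> (\<forall>y\<in>T. p (r y) = y)"
    and onto: "\<forall>w\<in>C. p w \<in> T \<longrightarrow> (\<exists>r\<in>R. r (p w) = w)"
    and disj: "pairwise (\<lambda>r r'. \<forall>y\<in>T. r y \<noteq> r' y) R"
    using sections[OF \<open>x \<in> B\<close>] by (elim exE conjE) (rule that)
  have R: "continuous_on T r" "r ` T \<subseteq> C" "\<And>y. y \<in> T \<Longrightarrow> p (r y) = y" if "r \<in> R" for r
    using R that by blast+
  have disj: "r y \<noteq> r' y" if "r \<in> R" "r' \<in> R" "r \<noteq> r'" "y \<in> T" for r r' y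
    using disj that unfolding pairwise_def by blast
  define D where "D = C \<inter> p -` T"
  have D: "openin (top_of_set C) D"
    unfolding D_def using p T(2) by (intro continuous_openin_preimage[of C p B]) auto
  have sheet: "r ` T = {w \<in> D. r (p w) = w}" if "r \<in> R" for r
    using R(2,3)[OF that] by (auto simp: D_def image_iff) (metis)
  have closed: "closedin (top_of_set D) (r ` T)" if r: "r \<in> R" for r
  proof -
    have "continuous_on D p"
      using p(1) by (rule continuous_on_subset) (auto simp: D_def)
    moreover have "continuous_on D (\<lambda>w. r (p w))"
      by (rule continuous_on_compose2[OF R(1)[OF r] calculation]) (auto simp: D_def)
    ultimately have "continuous_on D (\<lambda>w. r (p w) - w)"
      by (intro continuous_intros)
    then have "closedin (top_of_set D) {w \<in> D. r (p w) - w = 0}"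
      by (rule continuous_closedin_preimage_constant)
    then show ?thesis
      by (simp add: sheet[OF r])
  qed
  \<comment> \<open>Each sheet is open, since its complement is the union of the finitely many other ones.\<close>
  have sheet_open: "openin (top_of_set C) (r ` T)" if r: "r \<in> R" for r
  proof -
    have "closedin (top_of_set D) (\<Union>r'\<in>R - {r}. r' ` T)"
      using \<open>finite R\<close> closed by (intro closedin_Union) auto
    moreover have "D - (\<Union>r'\<in>R - {r}. r' ` T) = r ` T"
    proof (intro subset_antisym subsetI)
      fix w
      assume w: "w \<in> D - (\<Union>r'\<in>R - {r}. r' ` T)"
      then obtain r' where "r' \<in> R" "r' (p w) = w" "w \<in> D"
        using onto by (auto simp: D_def)
      then show "w \<in> r ` T"
        using sheet[of r'] w by (cases "r' = r") auto
    next
      fix w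
      assume w: "w \<in> r ` T"
      have "w \<notin> r' ` T" if "r' \<in> R" "r' \<noteq> r" for r'
        using w disj[OF r that(1)] that R(3) r by (metis imageE)
      then show "w \<in> D - (\<Union>r'\<in>R - {r}. r' ` T)"
        using w sheet[OF r] by auto
    qed
    ultimately have "openin (top_of_set D) (r ` T)"
      by (metis openin_closedin_eq topspace_euclidean_subtopology openin_diff openin_topspace)
    then show ?thesis
      using D openin_trans by blast
  qed
  have cover: "\<Union>((\<lambda>r. r ` T) ` R) = C \<inter> p -` T"
    using sheet onto by (fastforce simp: D_def)
  have disjoint: "pairwise disjnt ((\<lambda>r. r ` T) ` R)"
  proof -
    have "r = r'" if r: "r \<in> R" "r' \<in> R" and y: "y \<in> T" "y' \<in> T" "r y = r' y'" for r r' y y'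
    proof -
      have "y = y'"
        using R(3)[OF r(1) y(1)] R(3)[OF r(2) y(2)] y(3) by simp
      then show ?thesis
        using disj[OF r _ y(1)] y(3) by blast
    qed
    then show ?thesis
      unfolding pairwise_def disjnt_def by blast
  qed
  have homeo: "homeomorphism (r ` T) T p r" if "r \<in> R" for r
  proof (rule homeomorphismI)
    show "continuous_on (r ` T) p"
      using p(1) R(2)[OF that] by (rule continuous_on_subset)
    show "continuous_on T r"
      using that by (rule R(1))
  qed (use R(3)[OF that] in auto)
  show "\<exists>T. x \<in> T \<and> openin (top_of_set B) T \<and> (\<exists>v. \<Union>v = C \<inter> p -` T \<and>
      (\<forall>u\<in>v. openin (top_of_set C) u) \<and> pairwise disjnt v \<and> (\<forall>u\<in>v. \<exists>q. homeomorphism u T p q))"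
  proof (intro exI[of _ T] conjI exI[of _ "(\<lambda>r. r ` T) ` R"] ballI)
    fix u
    assume "u \<in> (\<lambda>r. r ` T) ` R"
    then obtain r where r: "r \<in> R" "u = r ` T"
      by blast
    show "openin (top_of_set C) u"
      using sheet_open[OF r(1)] r(2) by simp
    show "\<exists>q. homeomorphism u T p q"
      using homeo[OF r(1)] r(2) by blast
  qed (fact T cover disjoint)+
qed

definition quartic :: "complex \<Rightarrow> complex" where
  "quartic w = (w\<^sup>2 - 1)\<^sup>2"

definition quartic_cover :: "complex set" where
  "quartic_cover = {w. quartic w \<noteq> 0 \<and> quartic w \<noteq> 1}"

text \<open>On a disc there is a continuous square root \<open>g\<close>, and \<open>1 + g\<close>, \<open>1 - g\<close> have continuous square
  roots \<open>a\<close>, \<open>b\<close>; the sections are \<open>\<plusminus> a\<close> and \<open>\<plusminus> b\<close>.\<close>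

lemma covering_space_quartic: "covering_space quartic_cover quartic (- {0, 1})"
proof (rule covering_space_finite_sections)
  show "continuous_on quartic_cover quartic"
    unfolding quartic_def by (intro continuous_intros)
  have "quartic (csqrt (1 + csqrt z)) = z" for z
    by (simp add: quartic_def)
  then show "quartic ` quartic_cover = - {0, 1}"
    unfolding quartic_cover_def by (auto simp: image_iff) metis
  fix z :: complex
  assume z: "z \<in> - {0, 1}"
  moreover have "open (- {0, 1 :: complex})"
    by (intro open_Compl) auto
  ultimately obtain \<epsilon> where \<epsilon>: "0 < \<epsilon>" "ball z \<epsilon> \<subseteq> - {0, 1}"
    unfolding open_contains_ball by blast
  let ?T = "ball z \<epsilon>"
  have contr: "contractible ?T"
    by (simp add: convex_imp_contractible)
  obtain g where g: "continuous_on ?T g" "\<And>y. y \<in> ?T \<Longrightarrow> y = (g y)\<^sup>2"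
    by (rule continuous_sqrt_on_contractible[OF continuous_on_id contr]) (use \<epsilon>(2) in blast)+
  have g_ne: "g y \<noteq> 0" "1 + g y \<noteq> 0" "1 - g y \<noteq> 0" if "y \<in> ?T" for y
  proof -
    have "(g y)\<^sup>2 \<noteq> 0" "(g y)\<^sup>2 \<noteq> 1"
      using g(2)[OF that] \<epsilon>(2) that by (metis Compl_iff insertCI subsetD)+
    then show "g y \<noteq> 0" "1 + g y \<noteq> 0" "1 - g y \<noteq> 0"
      by (auto simp: add_eq_0_iff)
  qed
  obtain a where a: "continuous_on ?T a" "\<And>y. y \<in> ?T \<Longrightarrow> 1 + g y = (a y)\<^sup>2"
    by (rule continuous_sqrt_on_contractible[OF _ contr, of "\<lambda>y. 1 + g y"])
      (use g g_ne in \<open>auto intro!: continuous_intros\<close>)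
  obtain b where b: "continuous_on ?T b" "\<And>y. y \<in> ?T \<Longrightarrow> 1 - g y = (b y)\<^sup>2"
    by (rule continuous_sqrt_on_contractible[OF _ contr, of "\<lambda>y. 1 - g y"])
      (use g g_ne in \<open>auto intro!: continuous_intros\<close>)
  define R where "R = {a, \<lambda>y. - a y, b, \<lambda>y. - b y}"
  have q: "quartic (r y) = y" if "r \<in> R" "y \<in> ?T" for r y
    using that a(2)[OF that(2), symmetric] b(2)[OF that(2), symmetric] g(2)[OF that(2), symmetric]
    by (auto simp: R_def quartic_def)
  show "\<exists>T R. z \<in> T \<and> openin (top_of_set (- {0, 1})) T \<and> finite R \<and>
      (\<forall>r\<in>R. continuous_on T r \<and> r ` T \<subseteq> quartic_cover \<and> (\<forall>y\<in>T. quartic (r y) = y)) \<and>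
      (\<forall>w\<in>quartic_cover. quartic w \<in> T \<longrightarrow> (\<exists>r\<in>R. r (quartic w) = w)) \<and>
      pairwise (\<lambda>r r'. \<forall>y\<in>T. r y \<noteq> r' y) R"
  proof (intro exI[of _ ?T] exI[of _ R] conjI ballI impI)
    show "z \<in> ?T" "openin (top_of_set (- {0, 1})) ?T" "finite R"
      using \<epsilon> by (auto simp: R_def intro: open_subset)
    show "continuous_on ?T r" if "r \<in> R" for r
      using that a(1) b(1) by (auto simp: R_def intro: continuous_on_minus)
    show "r ` ?T \<subseteq> quartic_cover" if "r \<in> R" for r
      using q[OF that] \<epsilon>(2) by (auto simp: quartic_cover_def)
    show "quartic (r y) = y" if "r \<in> R" "y \<in> ?T" for r y
      using that by (rule q)
    show "\<exists>r\<in>R. r (quartic w) = w" if "quartic w \<in> ?T" for w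
    proof -
      let ?y = "quartic w"
      have "(w\<^sup>2 - 1)\<^sup>2 = (g ?y)\<^sup>2"
        using g(2)[OF that] by (simp add: quartic_def)
      then have "w\<^sup>2 = 1 + g ?y \<or> w\<^sup>2 = 1 - g ?y"
        by (auto simp: power2_eq_iff algebra_simps)
      then have "w\<^sup>2 = (a ?y)\<^sup>2 \<or> w\<^sup>2 = (b ?y)\<^sup>2"
        using a(2)[OF that] b(2)[OF that] by simp
      then show ?thesis
        by (auto simp: R_def power2_eq_iff)
    qed
    have "a y \<noteq> 0" "b y \<noteq> 0" "a y \<noteq> b y" "b y \<noteq> a y" "a y + b y \<noteq> 0" "b y + a y \<noteq> 0" if "y \<in> ?T" for y
    proof -
      have "(a y)\<^sup>2 \<noteq> 0" "(b y)\<^sup>2 \<noteq> 0" "(a y)\<^sup>2 \<noteq> (b y)\<^sup>2"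
        using g_ne[OF that] by (simp_all flip: a(2)[OF that] b(2)[OF that] add: eq_neg_iff_add_eq_0)
      then show "a y \<noteq> 0" "b y \<noteq> 0" "a y \<noteq> b y" "b y \<noteq> a y" "a y + b y \<noteq> 0" "b y + a y \<noteq> 0"
        by (auto simp: add_eq_0_iff)
    qed
    then show "pairwise (\<lambda>r r'. \<forall>y\<in>?T. r y \<noteq> r' y) R"
      unfolding pairwise_def R_def by (auto simp: eq_neg_iff_add_eq_0 neg_eq_iff_add_eq_0 equation_minus_iff)
  qed
qed


section \<open>Detecting the product over the Cantor gaps\<close>

text \<open>The retraction of \<open>earring_plus\<close> onto its \<open>n\<close>-th circle that sends all other points to 0.  The
  quotient \<open>2 * Re z / (norm z)\<^sup>2\<close> equals \<open>m\<close> on the \<open>m\<close>-th circle and is at most 0 on the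
  whisker, and the formula makes sense and is continuous on the whole plane.\<close>

definition circle_part :: "nat \<Rightarrow> complex \<Rightarrow> complex" where
  "circle_part n z = of_real (max 0 (1 - \<bar>2 * Re z / (norm z)\<^sup>2 - real n\<bar>)) * z"

lemma continuous_on_circle_part: "continuous_on A (circle_part n)"
proof -
  have "isCont (circle_part n) z" for z
  proof (cases "z = 0")
    case True
    have "norm (circle_part n w) \<le> norm w" for w
      by (auto simp: circle_part_def norm_mult max_def intro: mult_left_le_one_le)
    moreover have "((\<lambda>w::complex. norm w) \<longlongrightarrow> 0) (at 0)"
      by (intro tendsto_eq_intros) auto
    ultimately have "(circle_part n \<longlongrightarrow> 0) (at 0)"
      by (intro Lim_null_comparison[of "circle_part n" norm]) auto
    then show ?thesis
      by (simp add: True isCont_def circle_part_def[of n 0])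
  next
    case False
    then show ?thesis
      unfolding circle_part_def by (intro continuous_intros) auto
  qed
  then show ?thesis
    by (simp add: continuous_at_imp_continuous_on)
qed

lemma circle_part_circle:
  assumes "1 \<le> m" "z \<in> earring_circle m"
  shows "circle_part n z = (if m = n then z else 0)"
proof (cases "z = 0")
  case False
  then have "2 * Re z / (norm z)\<^sup>2 = real m"
    using assms by (simp add: earring_circle_iff field_simps)
  moreover have "1 \<le> \<bar>real m - real n\<bar>" if "m \<noteq> n"
    using that by linarith
  ultimately show ?thesis
    by (auto simp: circle_part_def)
qed (simp add: circle_part_def)

lemma circle_part_whisker: "1 \<le> n \<Longrightarrow> circle_part n (whisker t) = 0" if "t \<in> {0..1}"
proof -
  assume "1 \<le> n"
  have "2 * (t - 1) / \<bar>t - 1\<bar>\<^sup>2 \<le> 0"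
    using that by (intro divide_nonpos_nonneg) auto
  then show ?thesis
    using \<open>1 \<le> n\<close> by (simp add: circle_part_def whisker_def norm_of_real del: of_real_diff power2_abs)
qed

text \<open>The coefficients scale each of the circles 1, 3 and 4 to radius 1/2, and the signs put its centre
  at 1, 0 and 0 respectively; all of them pass through the base point 1/2.\<close>

definition detector :: "complex \<Rightarrow> complex" where
  "detector z = 1 / 2 + circle_part 1 z / 2 - 3 * circle_part 3 z / 2 - 2 * circle_part 4 z"

definition loop_zero :: "real \<Rightarrow> complex" where
  "loop_zero t = exp (2 * of_real pi * \<i> * of_real t) / 2"

definition loop_one :: "real \<Rightarrow> complex" where
  "loop_one t = 1 - exp (2 * of_real pi * \<i> * of_real t) / 2"

lemma detector_ell:
  assumes "1 \<le> m"
  shows "detector (ell m t) = (if m = 1 then loop_one t else if m \<in> {3, 4} then loop_zero t else 1 / 2)"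
proof -
  have "circle_part n (ell m t) = (if m = n then ell m t else 0)" for n
    using circle_part_circle[OF assms ell_in_circle] .
  then show ?thesis
    by (auto simp: detector_def ell_def loop_one_def loop_zero_def field_simps)
qed

lemma detector_whisker: "t \<in> {0..1} \<Longrightarrow> detector (whisker t) = 1 / 2"
  by (simp add: detector_def circle_part_whisker)

lemma continuous_on_detector: "continuous_on A detector"
  unfolding detector_def by (intro continuous_intros continuous_on_circle_part) auto

lemma detector_maps: "detector ` earring_plus \<subseteq> - {0, 1}"
proof (intro image_subsetI)
  fix z
  assume "z \<in> earring_plus"
  then consider m where "1 \<le> m" "z \<in> earring_circle m" | x where "x \<in> {-1..0}" "z = of_real x"
    by (auto simp: earring_plus_def earring_def)
  then show "detector z \<in> - {0, 1}"
  proof cases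
    case 1
    define w where "w = of_nat m * z"
    have "1 - w = of_nat m * (1 / of_nat m - z)"
      using 1 by (simp add: w_def field_simps)
    then have "norm (1 - w) = 1"
      using 1 by (simp add: norm_mult earring_circle_def dist_norm norm_divide)
    then have "w \<noteq> 1" "w \<noteq> - 1"
      by auto
    then have "1 / 2 + w / 2 \<noteq> 0" "1 / 2 + w / 2 \<noteq> 1" "1 / 2 - w / 2 \<noteq> 0" "1 / 2 - w / 2 \<noteq> 1"
      by (auto simp: field_simps add_eq_0_iff)
    moreover have "detector z \<in> {1 / 2 + w / 2, 1 / 2 - w / 2, 1 / 2}"
      by (auto simp: detector_def circle_part_circle[OF 1] w_def)
    ultimately show ?thesis
      by auto
  next
    case 2
    then have "z = whisker (x + 1)" "x + 1 \<in> {0..1}"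
      by (auto simp: whisker_def)
    then have "detector z = 1 / 2"
      using detector_whisker by simp
    moreover have "1 / 2 \<in> - {0, 1 :: complex}"
      by simp
    ultimately show ?thesis
      by (simp only:)
  qed
qed

definition half_root :: complex where
  "half_root = of_real (sqrt (1 / 2))"

lemma half_root_squared: "half_root\<^sup>2 = 1 / 2"
  by (simp add: half_root_def flip: of_real_power)

lemma csqrt_half: "csqrt (1 / 2) = half_root"
  using of_real_sqrt[of "1 / 2"] by (simp add: half_root_def)

text \<open>The lifts that are needed: \<open>loop_zero\<close> lifts from \<open>base_lift\<close> to another point of the fibre,
  \<open>loop_one\<close> lifts to a loop at \<open>base_lift\<close>, but from that other point it lifts to a path to its
  negative.  With \<open>w = lift_one t\<close> and \<open>u = csqrt (loop_one t)\<close> one has \<open>w\<^sup>2 = 1 + u\<close>.  A square root of \<open>1 - u\<close>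
  along the same loop is not given by the principal branch; dividing a square root of
  \<open>1 - u\<^sup>2 = exp (2 * pi * \<i> * t) / 2\<close> by \<open>w\<close> gives one.\<close>

definition base_lift :: complex where
  "base_lift = csqrt (1 + half_root)"

definition lift_zero :: "real \<Rightarrow> complex" where
  "lift_zero t = csqrt (1 + half_root * exp (of_real pi * \<i> * of_real t))"

definition lift_one :: "real \<Rightarrow> complex" where
  "lift_one t = csqrt (1 + csqrt (loop_one t))"

definition lift_one_twisted :: "real \<Rightarrow> complex" where
  "lift_one_twisted t = half_root * exp (of_real pi * \<i> * of_real t) / lift_one t"

lemma half_turn_squared: "(exp (of_real pi * \<i> * of_real t))\<^sup>2 = exp (2 * of_real pi * \<i> * of_real t)"
  by (simp add: exp_double[symmetric] mult_ac)

lemma exp_pi_i_real: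
  "exp (of_real pi * \<i> * of_real t) = cis (pi * t)"
  "exp (2 * of_real pi * \<i> * of_real t) = cis (2 * pi * t)"
  by (simp_all add: cis_conv_exp mult_ac)

lemma quartic_lift_zero: "quartic (lift_zero t) = loop_zero t" "quartic (- lift_zero t) = loop_zero t"
  by (simp_all add: quartic_def lift_zero_def loop_zero_def power_mult_distrib half_turn_squared half_root_squared)

lemma quartic_lift_one: "quartic (lift_one t) = loop_one t"
  by (simp add: quartic_def lift_one_def)

text \<open>The principal root has nonnegative real part, so \<open>1 + csqrt z\<close> stays away from the branch cut.\<close>

lemma one_plus_csqrt: "1 + csqrt z \<noteq> 0" "1 + csqrt z \<notin> \<real>\<^sub>\<le>\<^sub>0"
proof -
  have "0 < Re (1 + csqrt z)"
    using Re_csqrt[of z] by (simp del: csqrt.simps)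
  then show "1 + csqrt z \<noteq> 0" "1 + csqrt z \<notin> \<real>\<^sub>\<le>\<^sub>0"
    unfolding complex_nonpos_Reals_iff by (metis less_irrefl zero_complex.sel(1), linarith)
qed

lemma lift_one_nonzero: "lift_one t \<noteq> 0"
  using one_plus_csqrt by (simp add: lift_one_def)

lemma quartic_lift_one_twisted: "quartic (lift_one_twisted t) = loop_one t"
proof -
  define u where "u = csqrt (loop_one t)"
  have u: "u\<^sup>2 = loop_one t" "1 + u \<noteq> 0"
    using one_plus_csqrt by (simp_all add: u_def)
  have "(lift_one_twisted t)\<^sup>2 = (1 - u\<^sup>2) / (1 + u)"
    by (simp add: lift_one_twisted_def lift_one_def power_divide power_mult_distrib half_turn_squared half_root_squared u(1))
      (simp add: loop_one_def u_def)
  also have "\<dots> = 1 - u"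
    using u(2) unfolding divide_eq_eq[of "1 - u\<^sup>2"] by (simp add: power2_eq_square algebra_simps)
  finally show ?thesis
    using u(1) by (simp add: quartic_def)
qed

lemma continuous_on_lift_zero: "continuous_on A lift_zero"
proof -
  have "1 + half_root * exp (of_real pi * \<i> * of_real t) \<notin> \<real>\<^sub>\<le>\<^sub>0" for t
  proof -
    have "sqrt (1 / 2) * (- cos (pi * t)) \<le> sqrt (1 / 2) * 1"
      by (intro mult_left_mono) auto
    then have "0 < Re (1 + half_root * exp (of_real pi * \<i> * of_real t))"
      using real_sqrt_lt_1_iff[of "1 / 2"] unfolding half_root_def exp_pi_i_real
      by (simp del: real_sqrt_lt_1_iff)
    then show ?thesis
      by (auto simp: complex_nonpos_Reals_iff)
  qed
  then show ?thesis
    unfolding lift_zero_def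
    by (intro continuous_on_compose2[OF continuous_on_csqrt] continuous_intros) auto
qed

lemma continuous_on_lift_one: "continuous_on A lift_one"
proof -
  have "loop_one t \<notin> \<real>\<^sub>\<le>\<^sub>0" for t
  proof -
    have "0 < Re (loop_one t)"
      using cos_le_one[of "2 * pi * t"] unfolding loop_one_def exp_pi_i_real by (simp del: cos_le_one)
    then show ?thesis
      by (auto simp: complex_nonpos_Reals_iff)
  qed
  moreover have "continuous_on A loop_one"
    unfolding loop_one_def by (intro continuous_intros) auto
  ultimately show ?thesis
    unfolding lift_one_def using one_plus_csqrt(2)
    by (intro continuous_on_compose2[OF continuous_on_csqrt] continuous_intros) auto
qed

lemma continuous_on_lift_one_twisted: "continuous_on A lift_one_twisted"
  unfolding lift_one_twisted_def
  by (intro continuous_intros continuous_on_lift_one) (simp add: lift_one_nonzero)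

lemma base_lift: "quartic base_lift = 1 / 2" "base_lift \<noteq> 0" "base_lift \<in> quartic_cover"
proof -
  show "quartic base_lift = 1 / 2"
    by (simp add: quartic_def base_lift_def half_root_squared)
  then show "base_lift \<in> quartic_cover"
    unfolding quartic_cover_def by (simp only: mem_Collect_eq) simp
  show "base_lift \<noteq> 0"
    using one_plus_csqrt[of "1 / 2"] unfolding csqrt_half by (simp add: base_lift_def)
qed

lemma lift_ends:
  "lift_zero 0 = base_lift" "lift_one 0 = base_lift" "lift_one 1 = base_lift"
  "lift_one_twisted 0 = lift_zero 1" "lift_one_twisted 1 = - lift_zero 1"
proof -
  have exps: "exp (of_real pi * \<i>) = - 1" "exp (2 * of_real pi * \<i>) = 1"
    using exp_pi_i_real[of 1] by simp_all
  show "lift_zero 0 = base_lift"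
    by (simp add: lift_zero_def base_lift_def)
  show one: "lift_one 0 = base_lift" "lift_one 1 = base_lift"
    using exps by (simp_all add: lift_one_def base_lift_def loop_one_def csqrt_half)
  define r where "r = sqrt (1 / 2)"
  have r: "0 < r" "r < 1" "r\<^sup>2 = 1 / 2"
    by (simp_all add: r_def)
  have "lift_zero 1 = of_real (sqrt (1 - r))"
    using of_real_sqrt[of "1 - r"] r exps by (simp add: lift_zero_def half_root_def flip: r_def)
  moreover have "base_lift = of_real (sqrt (1 + r))"
    using of_real_sqrt[of "1 + r"] r by (simp add: base_lift_def half_root_def flip: r_def)
  moreover have "sqrt (1 - r) * sqrt (1 + r) = r"
  proof -
    have "(1 - r) * (1 + r) = r\<^sup>2"
      using r(3) by (simp add: algebra_simps power2_eq_square)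
    then have "sqrt ((1 - r) * (1 + r)) = r"
      using r(1) by simp
    then show ?thesis
      by (simp add: real_sqrt_mult)
  qed
  ultimately have "lift_zero 1 * base_lift = half_root"
    by (metis half_root_def r_def of_real_mult)
  then have "half_root / base_lift = lift_zero 1"
    using base_lift(2) by (simp add: field_simps)
  then show "lift_one_twisted 0 = lift_zero 1" "lift_one_twisted 1 = - lift_zero 1"
    using exps by (simp_all add: lift_one_twisted_def one)
qed

text \<open>The gap of length 1/9 on the left carries the second loop and precedes the middle gap with the
  first loop.  All indices from 3 on may be lumped together, since \<open>detector\<close> is constant on the
  circles \<open>2 * m - 1\<close> and \<open>2 * m\<close> for \<open>m \<ge> 3\<close>.\<close>

lemma ell_tau_gaps:
  assumes "t \<in> {0..1}"
  shows "t \<in> {1 / 9..2 / 9} \<Longrightarrow> ell_tau t = ell 2 (9 * t - 1)"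
    and "t \<in> {1 / 3..2 / 3} \<Longrightarrow> ell_tau t = ell 1 (3 * t - 1)"
    and "t \<notin> {1 / 9..2 / 9} \<union> {1 / 3..2 / 3} \<Longrightarrow> \<exists>m\<ge>3. \<exists>u. ell_tau t = ell m u"
proof -
  have left: "gap_left 0 = {1 / 3}" "gap_left (Suc 0) = {1 / 9, 7 / 9}"
    by auto
  have "{b \<in> gap_left 0. b \<le> 1 / 3} = {1 / 3}" "{b \<in> gap_left (Suc 0). b \<le> 1 / 9} = {1 / 9}"
    "{b \<in> gap_left (Suc 0). b \<le> 7 / 9} = {1 / 9, 7 / 9}"
    unfolding left by auto
  then have rank: "gap_rank (third_interval 0 (1 / 3)) = 1" "gap_rank (third_interval (Suc 0) (1 / 9)) = 1"
    "gap_rank (third_interval (Suc 0) (7 / 9)) = 2"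
    using gap_rank_third_interval(1)[of "1 / 3" 0] gap_rank_third_interval(1)[of "1 / 9" "Suc 0"]
      gap_rank_third_interval(1)[of "7 / 9" "Suc 0"] left by simp_all
  show "ell_tau t = ell 2 (9 * t - 1)" if "t \<in> {1 / 9..2 / 9}"
    using ell_tau_closed_gap[of "1 / 9" "Suc 0" t] that left rank by (simp add: algebra_simps numeral_2_eq_2)
  show "ell_tau t = ell 1 (3 * t - 1)" if "t \<in> {1 / 3..2 / 3}"
    using ell_tau_closed_gap[of "1 / 3" 0 t] that left rank by (simp add: algebra_simps)
  show "\<exists>m\<ge>3. \<exists>u. ell_tau t = ell m u" if t: "t \<notin> {1 / 9..2 / 9} \<union> {1 / 3..2 / 3}"
  proof (cases "t \<in> cantor_set")
    case True
    then have "ell_tau t = ell 3 0"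
      by (simp add: ell_tau_cantor)
    then show ?thesis
      by blast
  next
    case False
    then obtain n a where a: "a \<in> gap_left n" "t \<in> third_interval n a"
      using assms in_third_interval_iff by blast
    have "3 \<le> 2 ^ n + gap_rank (third_interval n a) - 1"
    proof -
      consider "n = 0" | "n = Suc 0" | "2 \<le> n"
        by linarith
      then show ?thesis
      proof cases
        case 1
        then show ?thesis
          using a t left by (simp add: third_interval_def)
      next
        case 2
        then have "a = 7 / 9"
          using a t left by (auto simp: third_interval_def)
        then show ?thesis
          unfolding 2 \<open>a = 7 / 9\<close> rank(3) by simp
      next
        case 3
        then have "(2::nat) ^ 2 \<le> 2 ^ n"
          by (intro power_increasing) auto
        then show ?thesis
          using gap_rank_third_interval(2)[OF a(1)] by simp
      qed
    qed
    then show ?thesis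
      using ell_tau_gap[OF a] by blast
  qed
qed

definition clamp_unit :: "real \<Rightarrow> real" where
  "clamp_unit x = max 0 (min 1 x)"

lemma loop_ends: "loop_zero 0 = 1 / 2" "loop_zero 1 = 1 / 2" "loop_one 0 = 1 / 2" "loop_one 1 = 1 / 2"
  by (simp_all add: loop_zero_def loop_one_def exp_two_pi_i)

text \<open>The image of the odd part of \<open>p_tau\<close> is \<open>loop_zero\<close> followed by \<open>loop_one\<close>, that of the even part
  is \<open>loop_zero\<close>, with constant pieces in between; 1/4 is a point between the two gaps.\<close>

lemma detector_tau:
  assumes "t \<in> {0..1}"
  shows "detector (f_odd (ell_tau t)) =
      (if t \<le> 1 / 4 then loop_zero (clamp_unit (9 * t - 1)) else loop_one (clamp_unit (3 * t - 1)))"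
    and "detector (f_even (ell_tau t)) = loop_zero (clamp_unit (9 * t - 1))"
proof -
  note odd = fun_cong[OF f_odd_ell, unfolded comp_def] and even = fun_cong[OF f_even_ell, unfolded comp_def]
  consider "t \<in> {1 / 9..2 / 9}" | "t \<in> {1 / 3..2 / 3}" | "t \<notin> {1 / 9..2 / 9} \<union> {1 / 3..2 / 3}"
    by blast
  then have "detector (f_odd (ell_tau t)) =
      (if t \<le> 1 / 4 then loop_zero (clamp_unit (9 * t - 1)) else loop_one (clamp_unit (3 * t - 1))) \<and>
    detector (f_even (ell_tau t)) = loop_zero (clamp_unit (9 * t - 1))"
  proof cases
    case 1
    then have "clamp_unit (9 * t - 1) = 9 * t - 1"
      by (simp add: clamp_unit_def)
    then show ?thesis
      using 1 by (simp add: ell_tau_gaps(1)[OF assms 1] odd even detector_ell)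
  next
    case 2
    then have "clamp_unit (3 * t - 1) = 3 * t - 1" "clamp_unit (9 * t - 1) = 1"
      by (simp_all add: clamp_unit_def)
    then show ?thesis
      using 2 by (simp add: ell_tau_gaps(2)[OF assms 2] odd even detector_ell loop_ends)
  next
    case 3
    obtain m u where m: "3 \<le> m" "ell_tau t = ell m u"
      using ell_tau_gaps(3)[OF assms 3] by blast
    then have "1 \<le> 2 * m - 1" "2 * m - 1 \<notin> {1, 3, 4}" "1 \<le> 2 * m" "2 * m \<notin> {1, 3, 4}"
      by auto
    then have "detector (f_odd (ell_tau t)) = 1 / 2" "detector (f_even (ell_tau t)) = 1 / 2"
      using m by (simp_all add: odd even detector_ell)
    moreover have "clamp_unit (9 * t - 1) \<in> {0, 1}" "t > 1 / 4 \<Longrightarrow> clamp_unit (3 * t - 1) \<in> {0, 1}"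
      using 3 by (auto simp: clamp_unit_def)
    ultimately show ?thesis
      by (auto simp: loop_ends)
  qed
  then show "detector (f_odd (ell_tau t)) =
      (if t \<le> 1 / 4 then loop_zero (clamp_unit (9 * t - 1)) else loop_one (clamp_unit (3 * t - 1)))"
    and "detector (f_even (ell_tau t)) = loop_zero (clamp_unit (9 * t - 1))"
    by auto
qed

lemma is_lift_detector:
  assumes "path_image \<gamma> \<subseteq> earring_plus" "path q"
    and "\<And>t. t \<in> {0..1} \<Longrightarrow> quartic (q t) = detector (\<gamma> t)"
  shows "is_lift quartic_cover quartic (detector \<circ> \<gamma>) q"
proof -
  have "q t \<in> quartic_cover" if "t \<in> {0..1}" for t
  proof -
    have "\<gamma> t \<in> earring_plus"
      using assms(1) that by (auto simp: path_image_def)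
    then show ?thesis
      using detector_maps assms(3)[OF that] by (auto simp: quartic_cover_def)
  qed
  then show ?thesis
    using assms(2,3) by (auto simp: is_lift_def path_image_def)
qed

definition detecting_subgroup :: "(real \<Rightarrow> complex) set set" where
  "detecting_subgroup = lift_stabilizer quartic_cover quartic base_lift detector earring_plus base_plus"

lemma base_plus: "base_plus \<in> earring_plus" "detector base_plus = 1 / 2"
proof -
  show "base_plus \<in> earring_plus"
    using whisker_path(2,3) by (metis pathstart_in_path_image subsetD)
  show "detector base_plus = 1 / 2"
    using detector_whisker[of 0] whisker_path(3) by (simp add: pathstart_def)
qed

lemma closed_detecting_subgroup:
  "closed_subgroup earring_plus base_plus c_subgroup c_tau earring_plus base_plus detecting_subgroup"
  unfolding detecting_subgroup_def
  by (intro closed_subgroup_lift_stabilizer[OF covering_space_quartic continuous_on_detector detector_maps])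
    (simp_all only: base_lift base_plus)

text \<open>Lifting \<open>\<alpha>\<close> followed by the reverse of \<open>\<beta>\<close> from \<open>base_lift\<close> amounts to choosing a lift of \<open>\<alpha>\<close>
  from there and a lift of \<open>\<beta>\<close> that ends where the first one ends; the whole lift ends where the
  latter starts.\<close>

lemma pair_in_detecting_subgroup_iff:
  assumes \<alpha>: "\<alpha> \<in> loops_at earring 0" and \<beta>: "\<beta> \<in> loops_at earring 0"
    and q: "path q" "pathstart q = base_lift" "\<And>t. t \<in> {0..1} \<Longrightarrow> quartic (q t) = detector (\<alpha> t)"
    and r: "path r" "pathfinish r = pathfinish q" "\<And>t. t \<in> {0..1} \<Longrightarrow> quartic (r t) = detector (\<beta> t)"
  shows "path_class earring_plus (whisker +++ \<alpha> +++ reversepath \<beta> +++ reversepath whisker) \<in> detecting_subgroup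
    \<longleftrightarrow> pathstart r = base_lift"
proof -
  let ?e = "\<lambda>_::real. base_lift" and ?e' = "\<lambda>_::real. pathstart r"
  have const: "path (\<lambda>_::real. c)" for c :: complex
    by (simp add: path_def)
  have sub: "path_image \<alpha> \<subseteq> earring_plus" "path_image \<beta> \<subseteq> earring_plus"
    using \<alpha> \<beta> by (auto simp: loops_at_def earring_plus_def)
  have "detector 0 = 1 / 2"
    by (simp add: detector_def circle_part_def)
  then have e': "quartic (pathstart r) = 1 / 2"
    using r(3)[of 0] \<beta> by (simp add: pathstart_def loops_at_def)
  have "is_lift quartic_cover quartic (detector \<circ> whisker) ?e"
    using whisker_path(2) const by (rule is_lift_detector) (simp add: base_lift(1) detector_whisker)
  moreover have "is_lift quartic_cover quartic (detector \<circ> \<alpha>) q"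
    using sub(1) q(1,3) by (rule is_lift_detector)
  moreover have "is_lift quartic_cover quartic (reversepath (detector \<circ> \<beta>)) (reversepath r)"
    using sub(2) r(1,3) by (intro is_lift_reversepath is_lift_detector)
  moreover have "is_lift quartic_cover quartic (reversepath (detector \<circ> whisker)) ?e'"
  proof -
    have "is_lift quartic_cover quartic (detector \<circ> whisker) ?e'"
      using whisker_path(2) const by (rule is_lift_detector) (simp add: e' detector_whisker)
    then show ?thesis
      using is_lift_reversepath by (fastforce simp: reversepath_def)
  qed
  ultimately have lift: "is_lift quartic_cover quartic
      ((detector \<circ> whisker) +++ (detector \<circ> \<alpha>) +++ reversepath (detector \<circ> \<beta>) +++ reversepath (detector \<circ> whisker))
      (?e +++ q +++ reversepath r +++ ?e')"
    using q(2) r(2) by (intro is_lift_join) (auto simp: pathstart_def pathfinish_def reversepath_def joinpaths_def)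
  have ends: "pathstart (?e +++ q +++ reversepath r +++ ?e') = base_lift"
    "pathfinish (?e +++ q +++ reversepath r +++ ?e') = pathstart r"
    by (auto simp: pathstart_def pathfinish_def joinpaths_def)
  have "(detector \<circ> whisker) +++ (detector \<circ> \<alpha>) +++ reversepath (detector \<circ> \<beta>) +++ reversepath (detector \<circ> whisker)
      = detector \<circ> (whisker +++ \<alpha> +++ reversepath \<beta> +++ reversepath whisker)"
    by (simp add: path_compose_join path_compose_reversepath)
  from class_in_lift_stabilizer_iff[OF covering_space_quartic continuous_on_detector detector_maps
      whiskered_loop_pair[OF \<alpha> \<beta>] lift[unfolded this] ends(1)]
  show ?thesis
    unfolding detecting_subgroup_def ends(2) .
qed

lemma p_subgroup_subset: "p_subgroup \<subseteq> detecting_subgroup"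
proof -
  interpret group "fundamental_group earring_plus base_plus"
    by (rule group_fundamental_group[OF base_plus(1)])
  have "p_elem n \<in> detecting_subgroup" if n: "1 \<le> n" for n
  proof -
    have idx: "1 \<le> 2 * n - 1" "1 \<le> 2 * n"
      using n by auto
    note iff = pair_in_detecting_subgroup_iff[OF ell_loop[OF idx(1)] ell_loop[OF idx(2)]]
    let ?e = "\<lambda>_::real. base_lift"
    have e: "path ?e" "pathstart ?e = base_lift" "pathfinish ?e = base_lift"
      by (simp_all add: path_def pathstart_def pathfinish_def)
    consider "n = 1" | "n = 2" | "3 \<le> n"
      using n by linarith
    then show ?thesis
    proof cases
      case 1
      show ?thesis
        unfolding p_elem_def
        using 1 e lift_ends by (subst iff[of lift_one ?e])
          (auto simp: detector_ell quartic_lift_one base_lift path_def continuous_on_lift_one pathstart_def pathfinish_def)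
    next
      case 2
      show ?thesis
        unfolding p_elem_def
        using 2 lift_ends by (subst iff[of lift_zero lift_zero])
          (auto simp: detector_ell quartic_lift_zero path_def continuous_on_lift_zero pathstart_def)
    next
      case 3
      show ?thesis
        unfolding p_elem_def
        using 3 e by (subst iff[of ?e ?e]) (auto simp: detector_ell base_lift)
    qed
  qed
  then show ?thesis
    unfolding p_subgroup_def using closed_detecting_subgroup
    by (intro generate_subgroup_incl) (auto simp: closed_subgroup_def)
qed

text \<open>The lift runs along \<open>lift_zero\<close> to the other point of the fibre, along \<open>lift_one_twisted\<close> to its
  negative, and back along the negative of \<open>lift_zero\<close>, to \<open>- base_lift\<close>.\<close>

lemma p_tau_not_in_detecting_subgroup: "p_tau \<notin> detecting_subgroup"
proof -
  define q where "q t = (if t \<le> 1 / 4 then lift_zero (clamp_unit (9 * t - 1))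
    else lift_one_twisted (clamp_unit (3 * t - 1)))" for t
  define r where "r t = - lift_zero (clamp_unit (9 * t - 1))" for t
  have clamp: "continuous_on A (\<lambda>t. clamp_unit (c * t - 1))" for A c
    unfolding clamp_unit_def by (intro continuous_intros)
  have cont_zero: "continuous_on A (\<lambda>t. lift_zero (clamp_unit (9 * t - 1)))" for A
    by (rule continuous_on_compose2[OF continuous_on_lift_zero[of UNIV] clamp]) auto
  have cont_one: "continuous_on A (\<lambda>t. lift_one_twisted (clamp_unit (3 * t - 1)))" for A
    by (rule continuous_on_compose2[OF continuous_on_lift_one_twisted[of UNIV] clamp]) auto
  have "continuous_on ({0..1/4} \<union> {1/4..1}) q"
    unfolding q_def using cont_zero cont_one
    by (intro continuous_on_cases) (auto simp: clamp_unit_def lift_ends)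
  moreover have "{0..1/4} \<union> {1/4..1} = {0..1::real}"
    by auto
  ultimately have q: "path q"
    by (simp add: path_def)
  have r: "path r"
    unfolding path_def r_def by (intro continuous_intros cont_zero)
  have ends: "pathstart q = base_lift" "pathfinish r = pathfinish q" "pathstart r = - base_lift"
    by (auto simp: q_def r_def pathstart_def pathfinish_def clamp_unit_def lift_ends)
  have "p_tau \<in> detecting_subgroup \<longleftrightarrow> pathstart r = base_lift"
    unfolding p_tau_def
    using compose_loop[OF f_odd_map ell_tau_loop] compose_loop[OF f_even_map ell_tau_loop] q ends(1) _ r ends(2)
    by (rule pair_in_detecting_subgroup_iff)
      (simp_all add: detector_tau q_def r_def quartic_lift_zero quartic_lift_one_twisted)
  then show ?thesis
    using ends(3) base_lift(2) by simp
qed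

theorem theorem3p25:
  shows "p_tau \<notin> subgroup_closure earring_plus base_plus c_subgroup c_tau
                    earring_plus base_plus p_subgroup"
  using closed_detecting_subgroup p_subgroup_subset p_tau_not_in_detecting_subgroup
  unfolding subgroup_closure_def by blast

end
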